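(* Let $G$ be a finite $2$-group of nilpotency class $2$ such that every automorphism of $G$ of order $2$ which fixes the Frattini subgroup $\Phi(G)$ elementwise is an inner automorphism of $G$. Then there exist positive integers $r,n$ with $2<2r\leq n$ such that $G$ is isomorphic to the group $$\langle a,b\mid a^{2^n}=b^{2^r}=1,\ a^{2^{n-r}}=[a,b]\rangle .$$
   Context: Class $2$ means nilpotency class exactly $2$ (in particular, $G$ is non-abelian). $\Phi(G)$ denotes the Frattini subgroup of $G$. $[a,b]=a^{-1}b^{-1}ab$ denotes the commutator. *)

theory Defs
  imports "HOL-Algebra.Algebra"
begin

section \<open>Commutators and nilpotency class\<close>

definition commutator :: "('a, 'b) monoid_scheme \<Rightarrow> 'a \<Rightarrow> 'a \<Rightarrow> 'a" where
  "commutator G x y = inv\<^bsub>G\<^esub> x \<otimes>\<^bsub>G\<^esub> inv\<^bsub>G\<^esub> y \<otimes>\<^bsub>G\<^esub> x \<otimes>\<^bsub>G\<^esub> y"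

text \<open>Indexing starts at \<open>0\<close>: \<open>lower_central G i\<close> is usually written
  \<open>\<gamma>\<^sub>i\<^sub>+\<^sub>1(G)\<close>.\<close>

primrec lower_central :: "('a, 'b) monoid_scheme \<Rightarrow> nat \<Rightarrow> 'a set" where
  "lower_central G 0 = carrier G"
| "lower_central G (Suc i) =
     generate G {commutator G x y | x y. x \<in> lower_central G i \<and> y \<in> carrier G}"

definition has_nilpotency_class :: "('a, 'b) monoid_scheme \<Rightarrow> nat \<Rightarrow> bool" where
  "has_nilpotency_class G c \<longleftrightarrow>
     lower_central G c = {\<one>\<^bsub>G\<^esub>} \<and> (\<forall>k<c. lower_central G k \<noteq> {\<one>\<^bsub>G\<^esub>})"

section \<open>The Frattini subgroup\<close>

definition maximal_subgroup :: "'a set \<Rightarrow> ('a, 'b) monoid_scheme \<Rightarrow> bool" where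
  "maximal_subgroup M G \<longleftrightarrow> subgroup M G \<and> M \<noteq> carrier G \<and>
     (\<forall>H. subgroup H G \<and> M \<subseteq> H \<longrightarrow> H = M \<or> H = carrier G)"

text \<open>If there is no maximal subgroup, this is the whole group.\<close>

definition Frattini :: "('a, 'b) monoid_scheme \<Rightarrow> 'a set" where
  "Frattini G = carrier G \<inter> \<Inter>{M. maximal_subgroup M G}"

section \<open>Inner automorphisms\<close>

text \<open>Elements of \<^const>\<open>auto\<close> are extensional functions, hence the bounded abstraction.\<close>

definition inner_auto :: "('a, 'b) monoid_scheme \<Rightarrow> ('a \<Rightarrow> 'a) set" where
  "inner_auto G = {(\<lambda>x\<in>carrier G. inv\<^bsub>G\<^esub> g \<otimes>\<^bsub>G\<^esub> x \<otimes>\<^bsub>G\<^esub> g) | g. g \<in> carrier G}"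

section \<open>Free groups and presentations\<close>

text \<open>A letter \<open>(x, True)\<close> stands for the generator \<open>x\<close>, and \<open>(x, False)\<close> for its
  formal inverse. The generating set is the whole type \<open>'g\<close>.\<close>

type_synonym 'g word = "('g \<times> bool) list"

inductive cancels :: "'g word \<Rightarrow> 'g word \<Rightarrow> bool" where
  "cancels (u @ [(x, s), (x, \<not> s)] @ v) (u @ v)"

definition free_eq :: "('g word \<times> 'g word) set" where
  "free_eq = {(u, v). equivclp cancels u v}"

definition free_group :: "'g word set monoid" where
  "free_group = \<lparr>carrier = UNIV // free_eq,
     monoid.mult = (\<lambda>U V. \<Union>u\<in>U. \<Union>v\<in>V. free_eq `` {u @ v}),
     one = free_eq `` {[]}\<rparr>"

definition free_gen :: "'g \<Rightarrow> 'g word set" where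
  "free_gen x = free_eq `` {[(x, True)]}"

definition normal_closure :: "('a, 'b) monoid_scheme \<Rightarrow> 'a set \<Rightarrow> 'a set" where
  "normal_closure G S = \<Inter>{N. N \<lhd> G \<and> S \<subseteq> N}"

text \<open>A relation \<open>u = v\<close> is the pair \<open>(u, v)\<close> of elements of the free group.\<close>

definition presented_group :: "('g word set \<times> 'g word set) set \<Rightarrow> 'g word set set monoid" where
  "presented_group E = free_group Mod
     normal_closure free_group {u \<otimes>\<^bsub>free_group\<^esub> inv\<^bsub>free_group\<^esub> v | u v. (u, v) \<in> E}"

datatype two_gens = Gen_a | Gen_b

definition metacyclic_2group :: "nat \<Rightarrow> nat \<Rightarrow> two_gens word set set monoid" where
  "metacyclic_2group n r =
     (let F = free_group; a = free_gen Gen_a; b = free_gen Gen_b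
      in presented_group
        {(a [^]\<^bsub>F\<^esub> ((2::nat) ^ n), \<one>\<^bsub>F\<^esub>),
         (b [^]\<^bsub>F\<^esub> ((2::nat) ^ r), \<one>\<^bsub>F\<^esub>),
         (a [^]\<^bsub>F\<^esub> ((2::nat) ^ (n - r)), commutator F a b)})"

subsection \<open>Well-definedness\<close>

lemma equiv_free_eq: "equiv UNIV free_eq"
  unfolding free_eq_def
  by (rule equivI) (auto simp: refl_on_def intro: sym_onI transI equivclp_sym equivclp_trans)

lemma cancels_append: "cancels u v \<Longrightarrow> cancels (p @ u @ q) (p @ v @ q)"
  by (induction rule: cancels.induct) (metis append.assoc cancels.intros)

lemma equivclp_append:
  assumes "equivclp cancels u v"
  shows "equivclp cancels (p @ u @ q) (p @ v @ q)"
  using assms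
proof (induction rule: equivclp_induct)
  case base
  then show ?case by simp
next
  case (step y z)
  then have "equivclp cancels (p @ y @ q) (p @ z @ q)"
    by (meson cancels_append r_into_equivclp converse_r_into_equivclp)
  with step.IH show ?case by (rule equivclp_trans)
qed

lemma free_eq_append:
  assumes "(u, u') \<in> free_eq" "(v, v') \<in> free_eq"
  shows "(u @ v, u' @ v') \<in> free_eq"
  using assms equivclp_append[of u u' "[]" v] equivclp_append[of v v' u' "[]"]
  by (auto simp: free_eq_def intro: equivclp_trans)

lemma free_group_mult:
  "free_eq `` {u} \<otimes>\<^bsub>free_group\<^esub> free_eq `` {v} = free_eq `` {u @ v}"
proof -
  have "congruent2 free_eq free_eq (\<lambda>u v. free_eq `` {u @ v})"
    by (rule congruent2I')
      (meson equiv_class_eq[OF equiv_free_eq] free_eq_append)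
  then show ?thesis
    using UN_equiv_class2[OF equiv_free_eq equiv_free_eq] by (simp add: free_group_def)
qed

lemma carrier_free_group: "carrier free_group = range (\<lambda>u. free_eq `` {u})"
  by (auto simp: free_group_def quotient_def)

lemma one_free_group: "\<one>\<^bsub>free_group\<^esub> = free_eq `` {[]}"
  by (simp add: free_group_def)

definition word_inv :: "'g word \<Rightarrow> 'g word" where
  "word_inv u = rev (map (\<lambda>(x, s). (x, \<not> s)) u)"

lemma word_inv_left: "(word_inv u @ u, []) \<in> free_eq"
proof (induction u)
  case Nil
  then show ?case by (simp add: word_inv_def free_eq_def)
next
  case (Cons c u)
  obtain x s where c: "c = (x, s)" by fastforce
  have "cancels (word_inv u @ [(x, \<not> s), (x, \<not> \<not> s)] @ u) (word_inv u @ u)"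
    by (rule cancels.intros)
  then have "cancels (word_inv (c # u) @ c # u) (word_inv u @ u)"
    by (simp add: c word_inv_def)
  with Cons show ?case
    by (auto simp: free_eq_def intro: equivclp_trans r_into_equivclp)
qed

lemma group_free_group: "group free_group"
proof (rule groupI)
  fix U assume "U \<in> carrier free_group"
  then obtain u where U: "U = free_eq `` {u}" by (auto simp: carrier_free_group)
  have "free_eq `` {word_inv u} \<otimes>\<^bsub>free_group\<^esub> U = \<one>\<^bsub>free_group\<^esub>"
    unfolding U free_group_mult one_free_group
    by (rule equiv_class_eq[OF equiv_free_eq word_inv_left])
  then show "\<exists>V\<in>carrier free_group. V \<otimes>\<^bsub>free_group\<^esub> U = \<one>\<^bsub>free_group\<^esub>"
    by (auto simp: carrier_free_group)
qed (auto simp: carrier_free_group one_free_group free_group_mult)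

end

theory Submission
  imports Defs "HOL-Number_Theory.Cong"
begin

text \<open>
  Write \<open>Z\<close> for the center. Every involution of the form \<open>x \<mapsto> x \<delta>(x)\<close>, where \<open>\<delta>\<close> is a derivation that
  vanishes on the common kernel of all homomorphisms to \<open>\<int>/2\<close> (which contains the Frattini subgroup),
  has to be inner, so \<open>\<delta>\<close> takes values in \<open>Z\<close>. Taking \<open>\<delta>\<close> with values in the involutions of \<open>Z\<close>
  shows that \<open>Z\<close> has a unique involution \<open>\<zeta>\<close>, hence is cyclic. Let \<open>C = {g. g\<^sup>2 \<in> Z}\<close>.
  Derivations built from one element \<open>u\<close> of \<open>C\<close> with \<open>u\<^sup>2 = \<zeta>\<close> show \<open>C \<subseteq> G\<^sup>2 Z\<close>, so that \<open>C\<close> is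
  abelian, and derivations built from two involutions of \<open>C\<close> show that \<open>C/Z\<close> has order 4. Choosing
  \<open>c \<in> C\<close> whose square is not a square in \<open>Z\<close> and extracting a maximal \<open>2^k\<close>-th root modulo \<open>Z\<close> gives
  a generator \<open>a\<close> whose \<open>2^(k+1)\<close>-th power generates \<open>Z\<close>; a second generator \<open>b\<close> is then adjusted
  by powers of \<open>a\<close> and by an odd power until the defining relations hold.
\<close>

section \<open>Groups of class at most two\<close>

text \<open>An automorphism x -> x [x, g] that is conjugation by g has central
  \<open>\<delta>\<close>, since the class is 2. So each admissible \<open>\<delta>\<close> with a
  noncentral value is a contradiction, and each one with central values yields an element g that
  realizes it by commutators. The obstacle is that x -> x w^chi(x) squares to the identity only if
  chi(w) = 0. This is secured first with an involution v that is a power of a commutator, where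
  every character vanishes automatically. After that every character has the form x -> [x, g] with
  values in {1, zeta}, so \<open>C/Z\<close> is the group of characters of G and has the same order
  as \<open>G/(G^2 Z)\<close>. Order 4 therefore means two generators. Uniqueness of the involution
  is what makes this pairing have a single target. For the presentation, no order of the presented
  group is computed: a word has the same normal form in every group satisfying the relations, so a
  word that is trivial in G is trivial modulo every normal subgroup containing the relators.\<close>

context group
begin

lemma pow_two [simp]: "x \<in> carrier G \<Longrightarrow> x [^] (2::nat) = x \<otimes> x"
  by (simp add: numeral_2_eq_2)

lemma inv_cancel:
  assumes "x \<in> carrier G" "y \<in> carrier G"
  shows "inv x \<otimes> (x \<otimes> y) = y" "x \<otimes> (inv x \<otimes> y) = y"
  using assms by (simp_all flip: m_assoc)

lemma commutator_closed [simp]: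
  "x \<in> carrier G \<Longrightarrow> y \<in> carrier G \<Longrightarrow> commutator G x y \<in> carrier G"
  by (simp add: commutator_def)

lemma commutator_swap_mult:
  "x \<in> carrier G \<Longrightarrow> y \<in> carrier G \<Longrightarrow> x \<otimes> y = y \<otimes> x \<otimes> commutator G x y"
  by (simp add: commutator_def m_assoc inv_cancel)

lemma commutator_eq_one_iff:
  "x \<in> carrier G \<Longrightarrow> y \<in> carrier G \<Longrightarrow> commutator G x y = \<one> \<longleftrightarrow> x \<otimes> y = y \<otimes> x"
  using commutator_swap_mult by (metis commutator_closed l_cancel_one m_closed r_cancel_one)

lemma commutator_unique:
  assumes "x \<in> carrier G" "y \<in> carrier G" "c \<in> carrier G" "x \<otimes> y = y \<otimes> x \<otimes> c"
  shows "commutator G x y = c"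
  using assms commutator_swap_mult by (metis commutator_closed l_cancel m_closed)

lemma commutator_inv:
  "x \<in> carrier G \<Longrightarrow> y \<in> carrier G \<Longrightarrow> inv (commutator G x y) = commutator G y x"
  by (simp add: commutator_def inv_mult_group m_assoc)

lemma commutator_self [simp]: "x \<in> carrier G \<Longrightarrow> commutator G x x = \<one>"
  by (simp add: commutator_eq_one_iff)

lemma conj_eq_mult_commutator:
  "x \<in> carrier G \<Longrightarrow> g \<in> carrier G \<Longrightarrow> inv g \<otimes> x \<otimes> g = x \<otimes> commutator G x g"
  by (simp add: commutator_def m_assoc inv_cancel)

text \<open>Finite order turns inverses into natural powers, so exponent arithmetic, also for
  inverse letters of words, stays in \<open>nat\<close>.\<close>

lemma inv_eq_pow:
  assumes "x \<in> carrier G" "x [^] (k::nat) = \<one>" "0 < k"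
  shows "inv x = x [^] (k - 1)"
proof (rule inv_equality)
  have "x [^] (k - 1) \<otimes> x = x [^] Suc (k - 1)" by (simp only: nat_pow_Suc)
  then show "x [^] (k - 1) \<otimes> x = \<one>" using assms by simp
qed (use assms in auto)

definition center :: "'a set" where
  "center = {z \<in> carrier G. \<forall>x\<in>carrier G. x \<otimes> z = z \<otimes> x}"

lemma center_closed [simp]: "t \<in> center \<Longrightarrow> t \<in> carrier G"
  by (simp add: center_def)

lemma center_commute: "t \<in> center \<Longrightarrow> x \<in> carrier G \<Longrightarrow> t \<otimes> x = x \<otimes> t"
  by (auto simp only: center_def mem_Collect_eq)

lemma centerI:
  "t \<in> carrier G \<Longrightarrow> (\<And>x. x \<in> carrier G \<Longrightarrow> x \<otimes> t = t \<otimes> x) \<Longrightarrow> t \<in> center"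
  unfolding center_def by blast

lemma subgroup_center: "subgroup center G"
proof (rule subgroupI)
  show "center \<subseteq> carrier G" by auto
  have "\<one> \<in> center" by (rule centerI) auto
  then show "center \<noteq> {}" by blast
  fix t assume t: "t \<in> center"
  have "x \<otimes> inv t = inv t \<otimes> x" if x: "x \<in> carrier G" for x
  proof -
    have "inv t \<otimes> (x \<otimes> t) \<otimes> inv t = inv t \<otimes> (t \<otimes> x) \<otimes> inv t"
      using center_commute[OF t x] by simp
    then show ?thesis using t x by (simp add: m_assoc inv_cancel)
  qed
  then show "inv t \<in> center" using t by (intro centerI) auto
  fix s assume s: "s \<in> center"
  have "x \<otimes> (t \<otimes> s) = t \<otimes> s \<otimes> x" if x: "x \<in> carrier G" for x
    using s t x by (metis m_assoc center_closed center_commute)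
  then show "t \<otimes> s \<in> center" using s t by (intro centerI) auto
qed

lemma center_mult [simp, intro]: "s \<in> center \<Longrightarrow> t \<in> center \<Longrightarrow> s \<otimes> t \<in> center"
  by (rule subgroup.m_closed[OF subgroup_center])

lemma center_inv [simp, intro]: "t \<in> center \<Longrightarrow> inv t \<in> center"
  by (rule subgroup.m_inv_closed[OF subgroup_center])

lemma center_one [simp, intro]: "\<one> \<in> center"
  by (rule subgroup.one_closed[OF subgroup_center])

lemma center_pow [simp, intro]: "t \<in> center \<Longrightarrow> t [^] (n::nat) \<in> center"
  by (induction n) auto

lemma center_iff_commutator:
  "t \<in> center \<longleftrightarrow> t \<in> carrier G \<and> (\<forall>x\<in>carrier G. commutator G x t = \<one>)"
  unfolding center_def using commutator_eq_one_iff by blast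

lemma commutator_center [simp]:
  assumes "t \<in> center" "x \<in> carrier G"
  shows "commutator G x t = \<one>" "commutator G t x = \<one>"
  using assms center_commute[OF assms] by (auto simp: commutator_eq_one_iff)

end

locale class_two_group = group +
  assumes commutator_central [simp, intro]:
    "x \<in> carrier G \<Longrightarrow> y \<in> carrier G \<Longrightarrow> commutator G x y \<in> center"
begin

text \<open>The central element [x, w] slides past y. With the mirrored rule below this makes the
  commutator bilinear, the basic computing tool of the proof.\<close>

lemma commutator_mult_left:
  assumes "x \<in> carrier G" "y \<in> carrier G" "w \<in> carrier G"
  shows "commutator G (x \<otimes> y) w = commutator G x w \<otimes> commutator G y w"
proof (rule commutator_unique)
  let ?c = "commutator G x w" and ?d = "commutator G y w"
  have "x \<otimes> y \<otimes> w = x \<otimes> w \<otimes> y \<otimes> ?d"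
    using assms commutator_swap_mult[of y w] by (simp add: m_assoc)
  also have "\<dots> = w \<otimes> x \<otimes> ?c \<otimes> y \<otimes> ?d"
    using assms commutator_swap_mult[of x w] by simp
  also have "\<dots> = w \<otimes> x \<otimes> (y \<otimes> ?c) \<otimes> ?d"
    using assms center_commute[of ?c y] by (simp add: m_assoc)
  finally show "x \<otimes> y \<otimes> w = w \<otimes> (x \<otimes> y) \<otimes> (?c \<otimes> ?d)"
    using assms by (simp add: m_assoc)
qed (use assms in auto)

lemma commutator_mult_right:
  assumes "x \<in> carrier G" "y \<in> carrier G" "w \<in> carrier G"
  shows "commutator G w (x \<otimes> y) = commutator G w x \<otimes> commutator G w y"
proof -
  have "commutator G w (x \<otimes> y) = inv (commutator G (x \<otimes> y) w)"
    using assms by (simp add: commutator_inv)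
  also have "\<dots> = inv (commutator G y w) \<otimes> inv (commutator G x w)"
    using assms by (simp add: commutator_mult_left inv_mult_group)
  also have "\<dots> = commutator G w y \<otimes> commutator G w x"
    using assms by (simp add: commutator_inv)
  also have "\<dots> = commutator G w x \<otimes> commutator G w y"
    using assms by (intro center_commute) auto
  finally show ?thesis .
qed

lemma commutator_pow_left:
  assumes "x \<in> carrier G" "y \<in> carrier G"
  shows "commutator G (x [^] (n::nat)) y = commutator G x y [^] n"
  using assms by (induction n) (auto simp: commutator_mult_left)

lemma commutator_pow_right:
  assumes "x \<in> carrier G" "y \<in> carrier G"
  shows "commutator G x (y [^] (n::nat)) = commutator G x y [^] n"
  using assms by (induction n) (auto simp: commutator_mult_right)

text \<open>Collecting the factors moves successive copies of x past 0, 1, ..., n - 1 copies of y;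
  each crossing costs one central [y, x].\<close>

lemma mult_pow_class_two:
  assumes x: "x \<in> carrier G" and y: "y \<in> carrier G"
  shows "(x \<otimes> y) [^] (n::nat) = x [^] n \<otimes> y [^] n \<otimes> commutator G y x [^] (n choose 2)"
proof (induction n)
  case 0
  then show ?case by (simp add: numeral_2_eq_2)
next
  case (Suc n)
  let ?c = "commutator G y x"
  have c: "?c \<in> center" "?c \<in> carrier G" using x y by auto
  have "(x \<otimes> y) [^] Suc n = x [^] n \<otimes> y [^] n \<otimes> (?c [^] (n choose 2) \<otimes> (x \<otimes> y))"
    using x y by (simp add: Suc m_assoc)
  also have "\<dots> = x [^] n \<otimes> (y [^] n \<otimes> x) \<otimes> y \<otimes> ?c [^] (n choose 2)"
    using x y c center_commute[of "?c [^] (n choose 2)" "x \<otimes> y"] by (simp add: m_assoc)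
  also have "y [^] n \<otimes> x = x \<otimes> y [^] n \<otimes> ?c [^] n"
    using x y commutator_swap_mult[of "y [^] n" x] by (simp add: commutator_pow_left)
  also have "x [^] n \<otimes> (x \<otimes> y [^] n \<otimes> ?c [^] n) \<otimes> y \<otimes> ?c [^] (n choose 2)
      = x [^] n \<otimes> x \<otimes> (y [^] n \<otimes> y) \<otimes> (?c [^] n \<otimes> ?c [^] (n choose 2))"
    using x y c center_commute[of "?c [^] n" "y \<otimes> ?c [^] (n choose 2)"] center_commute[of "?c [^] n" "?c [^] (n choose 2)"] by (simp add: m_assoc)
  also have "\<dots> = x [^] Suc n \<otimes> y [^] Suc n \<otimes> ?c [^] (Suc n choose 2)"
    using c by (simp add: nat_pow_mult numeral_2_eq_2)
  finally show ?case .
qed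

lemma mult_square:
  assumes x: "x \<in> carrier G" and y: "y \<in> carrier G"
  shows "x \<otimes> y \<otimes> (x \<otimes> y) = x \<otimes> x \<otimes> (y \<otimes> y) \<otimes> commutator G y x"
  using mult_pow_class_two[OF x y, of 2] x y by simp

lemma mult_square_central:
  assumes x: "x \<in> carrier G" and y: "y \<in> center"
  shows "x \<otimes> y \<otimes> (x \<otimes> y) = x \<otimes> x \<otimes> (y \<otimes> y)"
  using mult_square[of x y] x y by simp

text \<open>The subgroup \<open>G^2 Z\<close>. Nothing has to be generated: x^2 y^2 differs from (x
  y)^2 by a commutator, which the central factor absorbs.\<close>

definition squares_mod_center :: "'a set" where
  "squares_mod_center = {x \<otimes> x \<otimes> t | x t. x \<in> carrier G \<and> t \<in> center}"

lemma squares_mod_centerI [intro]: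
  "x \<in> carrier G \<Longrightarrow> t \<in> center \<Longrightarrow> x \<otimes> x \<otimes> t \<in> squares_mod_center"
  by (auto simp: squares_mod_center_def)

lemma squares_mod_centerE:
  assumes "y \<in> squares_mod_center"
  obtains x t where "x \<in> carrier G" "t \<in> center" "y = x \<otimes> x \<otimes> t"
  using assms by (auto simp: squares_mod_center_def)

lemma center_subset_squares: "t \<in> center \<Longrightarrow> t \<in> squares_mod_center"
  using squares_mod_centerI[of \<one> t] by simp

lemma subgroup_squares_mod_center: "subgroup squares_mod_center G"
proof (rule subgroupI)
  show "squares_mod_center \<subseteq> carrier G" by (auto simp: squares_mod_center_def)
  show "squares_mod_center \<noteq> {}" using center_subset_squares by auto
  fix a assume "a \<in> squares_mod_center"
  then obtain x t where a: "x \<in> carrier G" "t \<in> center" "a = x \<otimes> x \<otimes> t"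
    by (rule squares_mod_centerE)
  have "inv a = inv x \<otimes> inv x \<otimes> inv t"
    using a center_commute[of "inv t" "inv x \<otimes> inv x"] by (simp add: inv_mult_group)
  then show "inv a \<in> squares_mod_center" using a by auto
  fix b assume "b \<in> squares_mod_center"
  then obtain y s where b: "y \<in> carrier G" "s \<in> center" "b = y \<otimes> y \<otimes> s"
    by (rule squares_mod_centerE)
  let ?c = "commutator G y x"
  have "x \<otimes> y \<otimes> (x \<otimes> y) \<otimes> inv ?c = x \<otimes> x \<otimes> (y \<otimes> y)"
    unfolding mult_square[OF a(1) b(1)] using a b by (simp add: m_assoc)
  moreover have "a \<otimes> b = x \<otimes> x \<otimes> (y \<otimes> y) \<otimes> (t \<otimes> s)"
    using a b center_commute[of t "y \<otimes> (y \<otimes> s)"] center_commute[of t s] by (simp add: m_assoc)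
  ultimately have "a \<otimes> b = x \<otimes> y \<otimes> (x \<otimes> y) \<otimes> inv ?c \<otimes> (t \<otimes> s)"
    by (simp only:)
  also have "\<dots> = x \<otimes> y \<otimes> (x \<otimes> y) \<otimes> (inv ?c \<otimes> (t \<otimes> s))"
    using a b by (intro m_assoc) auto
  finally have "a \<otimes> b = x \<otimes> y \<otimes> (x \<otimes> y) \<otimes> (inv ?c \<otimes> (t \<otimes> s))" .
  then show "a \<otimes> b \<in> squares_mod_center"
    using a b by (simp only:) (intro squares_mod_centerI, auto)
qed

end

text \<open>A homomorphism to \<open>\<int>/2\<close>, as the predicate of being mapped to the nontrivial element.\<close>

definition binary_character :: "('a, 'b) monoid_scheme \<Rightarrow> ('a \<Rightarrow> bool) \<Rightarrow> bool" where
  "binary_character G \<chi> \<longleftrightarrow>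
     (\<forall>x\<in>carrier G. \<forall>y\<in>carrier G. \<chi> (x \<otimes>\<^bsub>G\<^esub> y) = (\<chi> x \<noteq> \<chi> y))"

lemma binary_character_mult:
  "binary_character G \<chi> \<Longrightarrow> x \<in> carrier G \<Longrightarrow> y \<in> carrier G \<Longrightarrow>
     \<chi> (x \<otimes>\<^bsub>G\<^esub> y) = (\<chi> x \<noteq> \<chi> y)"
  by (simp add: binary_character_def)

section \<open>Characters to Z/2, the Frattini subgroup and \<open>G^2 Z\<close>\<close>

context group
begin

lemma binary_character_one: "binary_character G \<chi> \<Longrightarrow> \<not> \<chi> \<one>"
  using binary_character_mult[of G \<chi> \<one> \<one>] by simp

lemma binary_character_inv:
  "binary_character G \<chi> \<Longrightarrow> x \<in> carrier G \<Longrightarrow> \<chi> (inv x) = \<chi> x"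
  using binary_character_mult[of G \<chi> x "inv x"] binary_character_one[of \<chi>] by simp

lemma binary_character_pow:
  assumes "binary_character G \<chi>" "x \<in> carrier G"
  shows "\<chi> (x [^] (n::nat)) \<longleftrightarrow> odd n \<and> \<chi> x"
  using assms by (induction n) (auto simp: binary_character_one binary_character_mult)

lemma binary_character_commutator:
  assumes "binary_character G \<chi>" "x \<in> carrier G" "y \<in> carrier G"
  shows "\<not> \<chi> (commutator G x y)"
  using assms by (auto simp: commutator_def binary_character_mult binary_character_inv)

lemma binary_character_kernel:
  assumes \<chi>: "binary_character G \<chi>" 
  shows "subgroup {x \<in> carrier G. \<not> \<chi> x} G"
  by (rule subgroupI) (use \<chi> in \<open>auto simp: binary_character_mult binary_character_inv binary_character_one\<close>)

text \<open>A nonzero character has a kernel of index 2, hence maximal. This is how the Frattini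
  condition on automorphisms enters.\<close>

lemma Frattini_binary_character:
  assumes \<chi>: "binary_character G \<chi>" and y: "y \<in> Frattini G"
  shows "\<not> \<chi> y"
proof
  assume "\<chi> y"
  let ?M = "{x \<in> carrier G. \<not> \<chi> x}"
  have yG: "y \<in> carrier G" using y by (simp add: Frattini_def)
  have "maximal_subgroup ?M G"
    unfolding maximal_subgroup_def
  proof (intro conjI allI impI binary_character_kernel \<chi>)
    show "?M \<noteq> carrier G" using yG \<open>\<chi> y\<close> by auto
    fix H assume H: "subgroup H G \<and> ?M \<subseteq> H"
    show "H = ?M \<or> H = carrier G"
    proof (rule disjCI)
      assume "H \<noteq> carrier G"
      show "H = ?M"
      proof (rule ccontr)
        assume "H \<noteq> ?M"
        then obtain h where h: "h \<in> H" "\<chi> h" "h \<in> carrier G"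
          using H subgroup.subset by blast
        have "g \<in> H" if g: "g \<in> carrier G" for g
        proof (cases "\<chi> g")
          case True
          then have "g \<otimes> inv h \<in> ?M"
            using g h \<chi> by (auto simp: binary_character_mult binary_character_inv)
          then have "g \<otimes> inv h \<otimes> h \<in> H"
            using H h by (meson subgroup.m_closed subsetD)
          then show ?thesis using g h by (simp add: m_assoc)
        qed (use g H in auto)
        then show False using \<open>H \<noteq> carrier G\<close> H subgroup.subset by blast
      qed
    qed
  qed
  then show False using y \<open>\<chi> y\<close> by (auto simp: Frattini_def)
qed

end

context class_two_group
begin

text \<open>A subgroup maximal among those containing \<open>squares_mod_center\<close> but not \<open>x\<close> has index 2.\<close>

lemma binary_character_exists:
  assumes fin: "finite (carrier G)" and x: "x \<in> carrier G" "x \<notin> squares_mod_center"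
  obtains \<chi> where "binary_character G \<chi>" "\<chi> x"
proof -
  let ?S = squares_mod_center
  let ?A = "{H. subgroup H G \<and> ?S \<subseteq> H \<and> x \<notin> H}"
  have "finite ?A"
    by (rule finite_subset[of _ "Pow (carrier G)"]) (use fin in \<open>auto dest: subgroup.subset\<close>)
  moreover have "?S \<in> ?A" using x subgroup_squares_mod_center by auto
  ultimately have "\<exists>M\<in>?A. \<forall>H\<in>?A. M \<subseteq> H \<longrightarrow> M = H"
    by (intro finite_has_maximal) (simp, rule notI, simp only: empty_iff)
  then obtain M where M: "M \<in> ?A" and max: "\<forall>H\<in>?A. M \<subseteq> H \<longrightarrow> M = H"
    by (elim bexE)
  have MS: "subgroup M G" "?S \<subseteq> M" "x \<notin> M" using M by auto
  interpret M: subgroup M G by (rule MS)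
  have sq: "y \<otimes> y \<in> M" if "y \<in> carrier G" for y
    using squares_mod_centerI[OF that center_one] that MS by auto
  have cM: "commutator G y w \<in> M" if "y \<in> carrier G" "w \<in> carrier G" for y w
    using center_subset_squares commutator_central that MS by blast
  have yx: "y \<otimes> x \<in> M" if y: "y \<in> carrier G" "y \<notin> M" for y
  proof -
    \<comment> \<open>M together with yM is closed because squares and commutators lie in M. It
      exceeds M, so maximality puts x into it, and x = y h gives y x = y^2 h in M.\<close>
    let ?H = "M \<union> (\<lambda>h. y \<otimes> h) ` M"
    have H: "subgroup ?H G"
    proof (rule subgroupI)
      show "?H \<subseteq> carrier G" using y by auto
      show "?H \<noteq> {}" using M.one_closed by blast
      have inv: "inv (y \<otimes> h) = y \<otimes> (inv y \<otimes> inv y \<otimes> inv h \<otimes> commutator G (inv h) (inv y))" if "h \<in> M" for h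
        using commutator_swap_mult[of "inv h" "inv y"] that y
        by (simp add: inv_mult_group m_assoc inv_cancel)
      fix a assume a: "a \<in> ?H"
      show "inv a \<in> ?H"
      proof (cases "a \<in> M")
        case False
        then obtain h where h: "h \<in> M" "a = y \<otimes> h" using a by auto
        have "inv y \<otimes> inv y \<otimes> inv h \<otimes> commutator G (inv h) (inv y) \<in> M"
          using h y by (intro M.m_closed cM sq) auto
        then show ?thesis unfolding h inv[OF h(1)] by blast
      qed auto
      fix b assume b: "b \<in> ?H"
      have aG: "a \<in> carrier G" using a y by auto
      have 1: "a \<otimes> (y \<otimes> h) = y \<otimes> (a \<otimes> commutator G a y \<otimes> h)" if "h \<in> M" for h
      proof -
        have "a \<otimes> y \<otimes> h = y \<otimes> a \<otimes> commutator G a y \<otimes> h"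
          using commutator_swap_mult[of a y] y aG by simp
        then show ?thesis using that y aG by (simp add: m_assoc)
      qed
      show "a \<otimes> b \<in> ?H"
      proof (cases "b \<in> M")
        case bM: True
        show ?thesis
        proof (cases "a \<in> M")
          case True
          then show ?thesis using bM by auto
        next
          case False
          then obtain h where h: "h \<in> M" "a = y \<otimes> h" using a by auto
          then have "a \<otimes> b = y \<otimes> (h \<otimes> b)" using bM y by (simp add: m_assoc)
          then show ?thesis using h bM by auto
        qed
      next
        case False
        then obtain h where h: "h \<in> M" "b = y \<otimes> h" using b by auto
        have ab: "a \<otimes> b = y \<otimes> (a \<otimes> commutator G a y \<otimes> h)" using 1 h by simp
        show ?thesis
        proof (cases "a \<in> M")
          case True
          then have "a \<otimes> commutator G a y \<otimes> h \<in> M" using h cM aG y by auto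
          then show ?thesis using ab by auto
        next
          case False
          then obtain k where k: "k \<in> M" "a = y \<otimes> k" using a by auto
          have "a \<otimes> b = y \<otimes> y \<otimes> (k \<otimes> commutator G a y \<otimes> h)"
            unfolding ab using k h y aG by (simp add: m_assoc)
          moreover have "y \<otimes> y \<otimes> (k \<otimes> commutator G a y \<otimes> h) \<in> M"
            using h k y aG by (intro M.m_closed sq cM) auto
          ultimately show ?thesis by simp
        qed
      qed
    qed
    have "y \<in> ?H" using y M.one_closed by (metis UnI2 imageI r_one)
    then have "?H \<noteq> M" using y by auto
    then have "x \<in> ?H" using max H MS by auto
    then obtain h where h: "h \<in> M" "x = y \<otimes> h" using MS by auto
    then have "y \<otimes> x = y \<otimes> y \<otimes> h" using y by (simp add: m_assoc)
    then show ?thesis using sq y h by auto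
  qed
  \<comment> \<open>Comparing both factors with x shows that the complement of M is a single
    coset.\<close>
  have prod: "y \<otimes> w \<in> M" if "y \<in> carrier G" "y \<notin> M" "w \<in> carrier G" "w \<notin> M" for y w
  proof -
    have "y \<otimes> w = (y \<otimes> x) \<otimes> inv (w \<otimes> x) \<otimes> (w \<otimes> w)"
      using that x by (simp add: inv_mult_group m_assoc inv_cancel)
    moreover have "(y \<otimes> x) \<otimes> inv (w \<otimes> x) \<otimes> (w \<otimes> w) \<in> M"
      using that by (intro M.m_closed M.m_inv_closed yx sq)
    ultimately show ?thesis by simp
  qed
  have "binary_character G (\<lambda>y. y \<notin> M)"
    unfolding binary_character_def
  proof (intro ballI)
    fix y w assume yw: "y \<in> carrier G" "w \<in> carrier G"
    have "w \<in> M" if "y \<otimes> w \<in> M" "y \<in> M"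
    proof -
      have "inv y \<otimes> (y \<otimes> w) \<in> M" using that by blast
      then show ?thesis using yw by (simp flip: m_assoc)
    qed
    moreover have "y \<in> M" if "y \<otimes> w \<in> M" "w \<in> M"
    proof -
      have "(y \<otimes> w) \<otimes> inv w \<in> M" using that by blast
      then show ?thesis using yw by (simp add: m_assoc)
    qed
    ultimately show "(y \<otimes> w \<notin> M) = ((y \<notin> M) \<noteq> (w \<notin> M))"
      using prod yw by blast
  qed
  then show thesis using that MS by blast
qed

end

section \<open>Rigid groups and the uniqueness of the central involution\<close>

locale rigid_two_group = class_two_group +
  fixes m :: nat
  assumes fin: "finite (carrier G)"
    and pow_exponent: "x \<in> carrier G \<Longrightarrow> x [^] ((2::nat) ^ m) = \<one>"
    and nonabelian: "\<exists>x\<in>carrier G. \<exists>y\<in>carrier G. commutator G x y \<noteq> \<one>"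
    and involution_inner:
      "\<lbrakk>\<And>x. x \<in> carrier G \<Longrightarrow> \<alpha> x \<in> carrier G;
        \<And>x y. x \<in> carrier G \<Longrightarrow> y \<in> carrier G \<Longrightarrow> \<alpha> (x \<otimes> y) = \<alpha> x \<otimes> \<alpha> y;
        \<And>x. x \<in> carrier G \<Longrightarrow> \<alpha> (\<alpha> x) = x;
        \<And>x. x \<in> carrier G \<Longrightarrow> \<forall>\<chi>. binary_character G \<chi> \<longrightarrow> \<not> \<chi> x \<Longrightarrow> \<alpha> x = x\<rbrakk>
       \<Longrightarrow> \<exists>g\<in>carrier G. \<forall>x\<in>carrier G. \<alpha> x = x \<otimes> commutator G x g"
begin

text \<open>\<open>mult\<close> is the crossed homomorphism law, as \<open>\<delta>\<close> x times
  [\<open>\<delta>\<close> x, y] is the conjugate of \<open>\<delta>\<close> x by y. It makes x -> x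
  \<open>\<delta>\<close> x a homomorphism, and \<open>invol\<close> makes it self-inverse.\<close>

lemma derivation_inner:
  assumes closed: "\<And>x. x \<in> carrier G \<Longrightarrow> \<delta> x \<in> carrier G"
    and mult: "\<And>x y. x \<in> carrier G \<Longrightarrow> y \<in> carrier G \<Longrightarrow>
      \<delta> (x \<otimes> y) = \<delta> x \<otimes> commutator G (\<delta> x) y \<otimes> \<delta> y"
    and invol: "\<And>x. x \<in> carrier G \<Longrightarrow> \<delta> x \<otimes> \<delta> (x \<otimes> \<delta> x) = \<one>"
    and triv: "\<And>x. x \<in> carrier G \<Longrightarrow> \<forall>\<chi>. binary_character G \<chi> \<longrightarrow> \<not> \<chi> x \<Longrightarrow> \<delta> x = \<one>"
  shows "\<exists>g\<in>carrier G. \<forall>x\<in>carrier G. \<delta> x = commutator G x g"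
proof -
  have "\<exists>g\<in>carrier G. \<forall>x\<in>carrier G. x \<otimes> \<delta> x = x \<otimes> commutator G x g"
  proof (rule involution_inner)
    fix x assume x: "x \<in> carrier G"
    show "x \<otimes> \<delta> x \<in> carrier G" using x closed by simp
    show "x \<otimes> \<delta> x \<otimes> \<delta> (x \<otimes> \<delta> x) = x" using x closed invol by (simp add: m_assoc)
    fix y assume y: "y \<in> carrier G"
    have "x \<otimes> y \<otimes> \<delta> (x \<otimes> y) = x \<otimes> (y \<otimes> \<delta> x \<otimes> commutator G (\<delta> x) y) \<otimes> \<delta> y"
      using x y closed by (simp add: mult m_assoc)
    also have "\<dots> = x \<otimes> \<delta> x \<otimes> (y \<otimes> \<delta> y)"
      using x y closed by (simp add: commutator_def m_assoc inv_cancel)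
    finally show "x \<otimes> y \<otimes> \<delta> (x \<otimes> y) = x \<otimes> \<delta> x \<otimes> (y \<otimes> \<delta> y)" .
  next
    fix x assume x: "x \<in> carrier G" "\<forall>\<chi>. binary_character G \<chi> \<longrightarrow> \<not> \<chi> x"
    show "x \<otimes> \<delta> x = x" using triv[OF x] x(1) by simp
  qed
  then show ?thesis using closed by auto
qed

lemma power_is_involution:
  assumes "x \<in> carrier G" "x \<noteq> \<one>"
  obtains k where "x [^] ((2::nat) ^ k) \<noteq> \<one>" "x [^] ((2::nat) ^ k) \<otimes> x [^] ((2::nat) ^ k) = \<one>"
proof -
  define j where "j = (LEAST j. x [^] ((2::nat) ^ j) = \<one>)"
  have j: "x [^] ((2::nat) ^ j) = \<one>"
    unfolding j_def by (rule LeastI[of _ m]) (use assms pow_exponent in auto)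
  have "j \<noteq> 0" using j assms by (auto intro!: Nat.gr0I)
  then obtain k where k: "j = Suc k" by (cases j) auto
  have "x [^] ((2::nat) ^ k) \<noteq> \<one>" using not_less_Least[of k "\<lambda>j. x [^] ((2::nat) ^ j) = \<one>"] k j_def by auto
  moreover have "x [^] ((2::nat) ^ k) \<otimes> x [^] ((2::nat) ^ k) = \<one>"
    using j assms by (simp add: k nat_pow_mult mult_2)
  ultimately show thesis by (rule that)
qed

text \<open>Take an involution v that is a power of a commutator, so that chi(v) = 0 and x ->
  v^chi(x) is an admissible derivation. Were it x -> [x, g], its value at the central w would be 1,
  whereas chi(w) makes it v.\<close>

lemma binary_character_involution:
  assumes \<chi>: "binary_character G \<chi>" and w: "w \<in> center" "w \<otimes> w = \<one>"
  shows "\<not> \<chi> w"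
proof
  assume "\<chi> w"
  obtain x y where xy: "x \<in> carrier G" "y \<in> carrier G" "commutator G x y \<noteq> \<one>"
    using nonabelian by blast
  obtain k where k: "commutator G x y [^] ((2::nat) ^ k) \<noteq> \<one>"
      "commutator G x y [^] ((2::nat) ^ k) \<otimes> commutator G x y [^] ((2::nat) ^ k) = \<one>"
    using power_is_involution[OF commutator_closed[OF xy(1,2)] xy(3)] by blast
  define v where "v = commutator G x y [^] ((2::nat) ^ k)"
  have v: "v \<in> center" "v \<noteq> \<one>" "v \<otimes> v = \<one>" "\<not> \<chi> v"
    using k xy \<chi> by (auto simp: v_def binary_character_pow binary_character_commutator)
  have "\<exists>g\<in>carrier G. \<forall>x\<in>carrier G. (if \<chi> x then v else \<one>) = commutator G x g"
    by (rule derivation_inner) (use v \<chi> binary_character_one[OF \<chi>] in \<open>auto simp: binary_character_mult\<close>)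
  then obtain g where "g \<in> carrier G" "\<forall>x\<in>carrier G. (if \<chi> x then v else \<one>) = commutator G x g" by blast
  then show False using \<open>\<chi> w\<close> v w center_closed[of w] by fastforce
qed

text \<open>The previous lemma supplies chi(w) = 0, which makes x -> x w^chi(x) an involution for
  every central w of order dividing 2.\<close>

lemma binary_character_inner:
  assumes \<chi>: "binary_character G \<chi>" and w: "w \<in> center" "w \<otimes> w = \<one>"
  shows "\<exists>g\<in>carrier G. \<forall>x\<in>carrier G. commutator G x g = (if \<chi> x then w else \<one>)"
proof -
  have "\<exists>g\<in>carrier G. \<forall>x\<in>carrier G. (if \<chi> x then w else \<one>) = commutator G x g"
    by (rule derivation_inner)
      (use w \<chi> binary_character_involution[OF assms] binary_character_one[OF \<chi>] in \<open>auto simp: binary_character_mult\<close>)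
  then show ?thesis by metis
qed

text \<open>Among the g whose commutators raised to 2^k realize the character, take one with k
  maximal; g = h^2 t would give [x, g] = [x, h]^2 and allow k + 1. The exponent of G bounds k
  because the value at y is nontrivial.\<close>

lemma character_lift:
  assumes \<chi>: "binary_character G \<chi>" and y: "y \<in> carrier G" "\<chi> y"
    and w: "w \<in> center" "w \<otimes> w = \<one>" "w \<noteq> \<one>"
  obtains g and k :: nat where "g \<in> carrier G" "g \<notin> squares_mod_center"
    "\<forall>x\<in>carrier G. commutator G x g [^] ((2::nat) ^ k) = (if \<chi> x then w else \<one>)"
proof -
  define P where "P k \<longleftrightarrow> (\<exists>g\<in>carrier G. \<forall>x\<in>carrier G.
      commutator G x g [^] ((2::nat) ^ k) = (if \<chi> x then w else \<one>))" for k
  have P0: "P 0" unfolding P_def using binary_character_inner[OF \<chi> w(1,2)] by auto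
  have bound: "k \<le> m" if "P k" for k
  proof (rule ccontr)
    assume "\<not> k \<le> m"
    then have k: "(2::nat) ^ k = 2 ^ m * 2 ^ (k - m)" by (simp flip: power_add)
    obtain g where g: "g \<in> carrier G"
      "\<forall>x\<in>carrier G. commutator G x g [^] ((2::nat) ^ k) = (if \<chi> x then w else \<one>)"
      using \<open>P k\<close> unfolding P_def by (elim bexE)
    have "commutator G y g [^] ((2::nat) ^ k) = (commutator G y g [^] ((2::nat) ^ m)) [^] ((2::nat) ^ (k - m))"
      unfolding k by (rule nat_pow_pow[symmetric]) (use y g in simp)
    then have "commutator G y g [^] ((2::nat) ^ k) = \<one>"
      using y g pow_exponent[of "commutator G y g"] by simp
    then show False using w y bspec[OF g(2) y(1)] by simp
  qed
  obtain k where k: "P k" "\<And>j. P j \<Longrightarrow> j \<le> k"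
    using GreatestI_nat[of P 0 m] Greatest_le_nat[of P _ m] P0 bound by blast
  obtain g where g: "g \<in> carrier G"
    "\<forall>x\<in>carrier G. commutator G x g [^] ((2::nat) ^ k) = (if \<chi> x then w else \<one>)"
    using k(1) unfolding P_def by (elim bexE)
  have "g \<notin> squares_mod_center"
  proof
    assume "g \<in> squares_mod_center"
    then obtain h t where h: "h \<in> carrier G" "t \<in> center" "g = h \<otimes> h \<otimes> t"
      by (rule squares_mod_centerE)
    have "commutator G x h [^] ((2::nat) ^ Suc k) = commutator G x g [^] ((2::nat) ^ k)"
      if "x \<in> carrier G" for x
    proof -
      have "commutator G x g = commutator G x h [^] (2::nat)"
        using that h by (simp add: commutator_mult_right)
      then show ?thesis using that h by (simp only: nat_pow_pow commutator_closed) simp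
    qed
    then have "\<forall>x\<in>carrier G. commutator G x h [^] ((2::nat) ^ Suc k) = (if \<chi> x then w else \<one>)"
      using g(2) by simp
    then have "P (Suc k)" unfolding P_def using h(1) by (intro bexI)
    then have "Suc k \<le> k" by (rule k(2))
    then show False by simp
  qed
  then show thesis using that g by blast
qed

text \<open>Infinite descent on \<open>k\<close>: a character \<open>\<psi>\<close> with \<open>\<psi> g\<close> lifts, for the other involution \<open>w'\<close>, to some
  \<open>h\<close> with exponent \<open>l\<close>. Then \<open>[g, h]\<close> has the power \<open>w'\<close> at \<open>2^l\<close> and \<open>1\<close> or \<open>w\<close> at \<open>2^k\<close>, which forces \<open>l < k\<close>.\<close>

lemma involution_unique_aux:
  assumes "w \<in> center" "w \<otimes> w = \<one>" "w \<noteq> \<one>"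
    "w' \<in> center" "w' \<otimes> w' = \<one>" "w' \<noteq> \<one>" "w \<noteq> w'"
    "g \<in> carrier G" "g \<notin> squares_mod_center"
    "\<forall>x\<in>carrier G. commutator G x g [^] ((2::nat) ^ k) = (if \<chi> x then w else \<one>)"
  shows False
  using assms
proof (induction k arbitrary: w w' g \<chi> rule: less_induct)
  case (less k)
  note w = less.prems(1-3) and w' = less.prems(4-6) and neq = less.prems(7)
    and g = less.prems(8-10)
  obtain \<psi> where \<psi>: "binary_character G \<psi>" "\<psi> g"
    using binary_character_exists[OF fin g(1,2)] by blast
  obtain h l where h: "h \<in> carrier G" "h \<notin> squares_mod_center"
    "\<forall>x\<in>carrier G. commutator G x h [^] ((2::nat) ^ l) = (if \<psi> x then w' else \<one>)"
    using character_lift[OF \<psi>(1) g(1) \<psi>(2) w'] by blast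
  show False
  proof (cases "l < k")
    case True
    show False by (rule less.IH[OF True w' w _ h]) (use neq in auto)
  next
    case False
    let ?c = "commutator G g h"
    have "?c [^] ((2::nat) ^ l) = inv (commutator G h g [^] ((2::nat) ^ l))"
      using g h by (simp add: commutator_inv flip: nat_pow_inv)
    also have "commutator G h g [^] ((2::nat) ^ l)
        = (commutator G h g [^] ((2::nat) ^ k)) [^] ((2::nat) ^ (l - k))"
      using False by (subst nat_pow_pow[OF commutator_closed[OF h(1) g(1)]]) (simp flip: power_add)
    finally have c: "?c [^] ((2::nat) ^ l) = inv ((commutator G h g [^] ((2::nat) ^ k)) [^] ((2::nat) ^ (l - k)))" .
    have w_pow: "w [^] ((2::nat) ^ (l - k)) = \<one> \<or> w [^] ((2::nat) ^ (l - k)) = w"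
    proof (cases "l = k")
      case False
      then have "(2::nat) ^ (l - k) = 2 * 2 ^ (l - k - 1)"
        using \<open>\<not> l < k\<close> by (simp flip: power_Suc)
      then have "w [^] ((2::nat) ^ (l - k)) = (w [^] (2::nat)) [^] ((2::nat) ^ (l - k - 1))"
        using w by (simp only: nat_pow_pow center_closed)
      then show ?thesis using w by simp
    qed (use w in simp)
    have "inv w = w" using w inv_equality[of w w] by auto
    then have "?c [^] ((2::nat) ^ l) = \<one> \<or> ?c [^] ((2::nat) ^ l) = w"
      unfolding c using bspec[OF g(3) h(1)] w_pow by auto
    then show False using bspec[OF h(3) g(1)] \<psi> w' neq by auto
  qed
qed

text \<open>If G were \<open>G^2 Z\<close>, substituting this into itself would write every element
  as a 2^k-th power times a central element; k = m makes G abelian.\<close>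

lemma squares_mod_center_proper: "\<exists>g\<in>carrier G. g \<notin> squares_mod_center"
proof (rule ccontr)
  assume neg: "\<not> ?thesis"
  have all: "\<exists>x\<in>carrier G. \<exists>t\<in>center. g = x \<otimes> x \<otimes> t" if "g \<in> carrier G" for g
    using neg that squares_mod_centerE[of g] by blast
  have "\<exists>x\<in>carrier G. \<exists>t\<in>center. g = x [^] ((2::nat) ^ k) \<otimes> t" if "g \<in> carrier G" for g and k :: nat
    using that
  proof (induction k)
    case 0
    then show ?case by (intro bexI[of _ g] bexI[of _ \<one>]) auto
  next
    case (Suc k)
    then obtain x t where x: "x \<in> carrier G" "t \<in> center" "g = x [^] ((2::nat) ^ k) \<otimes> t" by blast
    obtain y s where y: "y \<in> carrier G" "s \<in> center" "x = y [^] (2::nat) \<otimes> s" using all[OF x(1)] by auto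
    have "x [^] ((2::nat) ^ k) = y [^] ((2::nat) ^ Suc k) \<otimes> s [^] ((2::nat) ^ k)"
      using y mult_pow_class_two[of "y [^] (2::nat)" s "2 ^ k"] by (simp add: nat_pow_pow del: pow_two)
    then have "g = y [^] ((2::nat) ^ Suc k) \<otimes> (s [^] ((2::nat) ^ k) \<otimes> t)"
      using x y by (simp add: m_assoc)
    then show ?case using x y by blast
  qed
  from this[of _ m] have "g \<in> center" if "g \<in> carrier G" for g
    using that pow_exponent by force
  then show False using nonabelian by auto
qed

lemma involution_unique:
  assumes w: "w \<in> center" "w \<otimes> w = \<one>" "w \<noteq> \<one>"
    and w': "w' \<in> center" "w' \<otimes> w' = \<one>" "w' \<noteq> \<one>"
  shows "w = w'"
proof (rule ccontr)
  assume neq: "w \<noteq> w'"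
  obtain y where y: "y \<in> carrier G" "y \<notin> squares_mod_center"
    using squares_mod_center_proper by blast
  obtain \<chi> where \<chi>: "binary_character G \<chi>" "\<chi> y" using binary_character_exists[OF fin y] by blast
  obtain g k where "g \<in> carrier G" "g \<notin> squares_mod_center"
    "\<forall>x\<in>carrier G. commutator G x g [^] ((2::nat) ^ k) = (if \<chi> x then w else \<one>)"
    using character_lift[OF \<chi>(1) y(1) \<chi>(2) w] by blast
  then show False by (rule involution_unique_aux[OF w w' neq])
qed

definition \<zeta> :: 'a where
  "\<zeta> = (SOME w. w \<in> center \<and> w \<otimes> w = \<one> \<and> w \<noteq> \<one>)"

lemma \<zeta>: "\<zeta> \<in> center" "\<zeta> \<otimes> \<zeta> = \<one>" "\<zeta> \<noteq> \<one>"
proof -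
  obtain x y where xy: "x \<in> carrier G" "y \<in> carrier G" "commutator G x y \<noteq> \<one>"
    using nonabelian by blast
  obtain k where k: "commutator G x y [^] ((2::nat) ^ k) \<noteq> \<one>"
      "commutator G x y [^] ((2::nat) ^ k) \<otimes> commutator G x y [^] ((2::nat) ^ k) = \<one>"
    using power_is_involution[OF commutator_closed[OF xy(1,2)] xy(3)] by blast
  have "commutator G x y [^] ((2::nat) ^ k) \<in> center" using xy by auto
  with k have "\<exists>w. w \<in> center \<and> w \<otimes> w = \<one> \<and> w \<noteq> \<one>" by blast
  then have "\<zeta> \<in> center \<and> \<zeta> \<otimes> \<zeta> = \<one> \<and> \<zeta> \<noteq> \<one>"
    unfolding \<zeta>_def by (rule someI_ex)
  then show "\<zeta> \<in> center" "\<zeta> \<otimes> \<zeta> = \<one>" "\<zeta> \<noteq> \<one>" by auto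
qed

lemma \<zeta>_unique: "t \<in> center \<Longrightarrow> t \<otimes> t = \<one> \<Longrightarrow> t = \<one> \<or> t = \<zeta>"
  using involution_unique[OF _ _ _ \<zeta>] by blast

end

section \<open>Elements with central square\<close>

context rigid_two_group
begin

section \<open>Powers, orders and the cyclic center\<close>

lemma inv_pow_exponent: "x \<in> carrier G \<Longrightarrow> inv x = x [^] ((2::nat) ^ m - 1)"
  by (rule inv_eq_pow) (auto simp: pow_exponent)

lemma pow_cong_exponent:
  assumes "x \<in> carrier G" "[i = j] (mod (2 ^ m))"
  shows "x [^] (i::nat) = x [^] j"
proof -
  have "x [^] (i::nat) = x [^] (i mod 2 ^ m)" if "x \<in> carrier G" for i
  proof -
    have "x [^] i = x [^] (2 ^ m * (i div 2 ^ m) + i mod 2 ^ m)" by simp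
    also have "\<dots> = (x [^] ((2::nat) ^ m)) [^] (i div 2 ^ m) \<otimes> x [^] (i mod 2 ^ m)"
      using that by (simp only: nat_pow_mult nat_pow_pow)
    finally show ?thesis using that pow_exponent by simp
  qed
  from this[of i] this[of j] show ?thesis using assms by (simp add: cong_def)
qed

lemma odd_root:
  assumes "odd i"
  obtains j where "\<And>x. x \<in> carrier G \<Longrightarrow> (x [^] (i::nat)) [^] (j::nat) = x" "odd j"
proof -
  \<comment> \<open>The exponent m + 1 keeps the modulus even when m = 0, so that the inverse j is
    visibly odd.\<close>
  have "coprime i (2 ^ (m + 1))" using assms by simp
  then obtain j where j: "[i * j = Suc 0] (mod (2 ^ (m + 1)))" using cong_solve_coprime_nat by blast
  have "[i * j = 1] (mod 2)" using j by (auto intro: cong_dvd_modulus_nat)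
  then have "odd j" by (auto simp: cong_def)
  have "[i * j = 1] (mod (2 ^ m))" using j by (auto intro: cong_dvd_modulus_nat)
  then have "(x [^] i) [^] j = x" if "x \<in> carrier G" for x
    using pow_cong_exponent[OF that, of "i * j" 1] that by (simp add: nat_pow_pow)
  then show thesis using \<open>odd j\<close> by (rule that)
qed

lemma power_pow_two: "x \<in> carrier G \<Longrightarrow> x [^] ((2::nat) ^ Suc k) = x [^] ((2::nat) ^ k) \<otimes> x [^] ((2::nat) ^ k)"
  by (simp add: nat_pow_mult mult_2)

text \<open>The order of t divides 2^(k+1) but not 2^k, hence is exactly 2^(k+1).\<close>

lemma exponent_of_zeta_power:
  assumes t: "t \<in> carrier G" "t [^] ((2::nat) ^ k) = \<zeta>" and j: "t [^] (j::nat) = \<one>"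
  shows "2 ^ Suc k dvd j"
proof -
  have "t [^] ((2::nat) ^ Suc k) = \<one>" using t \<zeta> power_pow_two[OF t(1), of k] by simp
  then have "ord t dvd 2 ^ Suc k" using pow_eq_id[OF t(1)] by blast
  then obtain l where l: "l \<le> Suc k" "ord t = 2 ^ l"
    using divides_primepow_nat[of 2 "ord t" "Suc k"] by auto
  have "\<not> ord t dvd 2 ^ k" using t \<zeta> pow_eq_id[OF t(1)] by metis
  then have "\<not> l \<le> k" using l by (auto simp: le_imp_power_dvd)
  then have "ord t = 2 ^ Suc k" using l by (simp add: le_Suc_eq)
  then show ?thesis using j pow_eq_id[OF t(1)] by metis
qed

lemma exponent_zeta_unique:
  assumes t: "t \<in> carrier G" "t [^] ((2::nat) ^ k) = \<zeta>" "t [^] ((2::nat) ^ l) = \<zeta>"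
  shows "k = l"
proof -
  have "k' \<le> l'" if "t [^] ((2::nat) ^ k') = \<zeta>" "t [^] ((2::nat) ^ l') = \<zeta>" for k' l' :: nat
  proof -
    have "t [^] ((2::nat) ^ Suc l') = \<one>" using t that \<zeta> power_pow_two[OF t(1), of l'] by simp
    then have "2 ^ Suc k' dvd (2::nat) ^ Suc l'" using exponent_of_zeta_power[OF t(1)] that by blast
    then have "Suc k' \<le> Suc l'" by (rule power_dvd_imp_le) simp
    then show ?thesis by simp
  qed
  then show ?thesis using t by (simp add: antisym)
qed

text \<open>As the center turns out to be a nontrivial cyclic 2-group, this subgroup has index 2 in
  it and its complement there consists of the generators.\<close>

definition center_squares :: "'a set" where
  "center_squares = {s \<otimes> s | s. s \<in> center}"

lemma center_squaresI: "s \<in> center \<Longrightarrow> s \<otimes> s \<in> center_squares"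
  by (auto simp: center_squares_def)

lemma center_squares_mult:
  "x \<in> center_squares \<Longrightarrow> y \<in> center_squares \<Longrightarrow> x \<otimes> y \<in> center_squares"
proof -
  assume "x \<in> center_squares" "y \<in> center_squares"
  then obtain s t where "s \<in> center" "t \<in> center" "x = s \<otimes> s" "y = t \<otimes> t"
    by (auto simp: center_squares_def)
  moreover from this have "s \<otimes> t \<otimes> (s \<otimes> t) = s \<otimes> s \<otimes> (t \<otimes> t)"
    by (simp add: mult_square_central)
  ultimately show ?thesis using center_squaresI[of "s \<otimes> t"] by simp
qed

lemma center_squares_inv:
  "x \<in> center_squares \<Longrightarrow> inv x \<in> center_squares"
proof -
  assume "x \<in> center_squares"
  then obtain s where "s \<in> center" "x = s \<otimes> s" by (auto simp: center_squares_def)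
  then show ?thesis using center_squaresI[of "inv s"] by (simp add: inv_mult_group)
qed

text \<open>An abelian 2-group with one involution is cyclic: s is chosen with the largest i such
  that s^(2^i) is \<open>\<zeta>\<close>, and induction on the exponent of t shows that t is a power
  of s.\<close>

lemma center_cyclic: "\<exists>s\<in>center. \<forall>t\<in>center. \<exists>i::nat. t = s [^] i"
proof -
  define P where "P i \<longleftrightarrow> (\<exists>s\<in>center. s [^] ((2::nat) ^ i) = \<zeta>)" for i
  have P0: "P 0" unfolding P_def using \<zeta> by (intro bexI[of _ \<zeta>]) auto
  have bound: "i \<le> m" if P: "P i" for i
  proof -
    from P obtain s where "s \<in> center" "s [^] ((2::nat) ^ i) = \<zeta>" unfolding P_def by blast
    then have "2 ^ Suc i dvd (2::nat) ^ m"
      using exponent_of_zeta_power pow_exponent center_closed by blast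
    then have "Suc i \<le> m" by (rule power_dvd_imp_le) simp
    then show ?thesis by simp
  qed
  obtain i where i: "P i" "\<And>j. P j \<Longrightarrow> j \<le> i"
    using GreatestI_nat[of P 0 m] Greatest_le_nat[of P _ m] P0 bound by blast
  obtain s where s: "s \<in> center" "s [^] ((2::nat) ^ i) = \<zeta>" using i unfolding P_def by blast
  have "\<exists>p::nat. t = s [^] p" if "t \<in> center" "t [^] ((2::nat) ^ j) = \<one>" for t and j :: nat
    using that
  proof (induction j arbitrary: t)
    case 0
    then show ?case by (intro exI[of _ 0]) auto
  next
    case (Suc j)
    let ?v = "t [^] ((2::nat) ^ j)"
    have "?v \<otimes> ?v = \<one>" using Suc.prems power_pow_two[of t j] by simp
    then consider "?v = \<one>" | "?v = \<zeta>" using \<zeta>_unique[of ?v] Suc.prems by auto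
    then show ?case
    proof cases
      case 1
      then show ?thesis using Suc by blast
    next
      case 2
      then have "j \<le> i" using i(2) Suc.prems unfolding P_def by blast
      \<comment> \<open>This power of s also reaches \<open>\<zeta>\<close> at 2^j, so the two
        involutions cancel in (t q)^(2^j) and the induction hypothesis applies to t q.\<close>
      define q where "q = s [^] ((2::nat) ^ (i - j))"
      have q: "q \<in> center" "q [^] ((2::nat) ^ j) = \<zeta>"
        using s \<open>j \<le> i\<close> by (simp_all add: q_def nat_pow_pow flip: power_add)
      have "(t \<otimes> q) [^] ((2::nat) ^ j) = \<one>"
        using q 2 Suc.prems \<zeta> by (simp add: mult_pow_class_two)
      then obtain p :: nat where p: "t \<otimes> q = s [^] p" using Suc.IH[of "t \<otimes> q"] Suc.prems q by auto
      have "t = t \<otimes> q \<otimes> inv q" using q Suc.prems by (simp add: m_assoc)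
      also have "\<dots> = s [^] p \<otimes> inv q" by (simp only: p)
      also have "\<dots> = s [^] (p + 2 ^ (i - j) * (2 ^ m - 1))"
        using s by (simp add: inv_pow_exponent q_def nat_pow_pow nat_pow_mult)
      finally show ?thesis by blast
    qed
  qed
  then show ?thesis using s pow_exponent center_closed by meson
qed

text \<open>A nonsquare is an odd power of a cyclic generator, and odd exponents can be
  inverted.\<close>

lemma center_generated_by_nonsquare:
  assumes "c \<in> center" "c \<notin> center_squares" "t \<in> center"
  shows "\<exists>i::nat. t = c [^] i"
proof -
  obtain s where s: "s \<in> center" "\<forall>t\<in>center. \<exists>i::nat. t = s [^] i" using center_cyclic by blast
  obtain i :: nat where i: "c = s [^] i" using s assms by blast
  have "odd i"
  proof
    assume "even i"
    then have "i div 2 + i div 2 = i" by presburger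
    then have "c = s [^] (i div 2) \<otimes> s [^] (i div 2)" using s i by (simp add: nat_pow_mult)
    then show False using center_squaresI[of "s [^] (i div 2)"] s assms by auto
  qed
  then obtain j :: nat where j: "\<And>x. x \<in> carrier G \<Longrightarrow> (x [^] i) [^] j = x" by (rule odd_root) blast
  obtain l :: nat where "t = s [^] l" using s assms by blast
  also have "s [^] l = (c [^] j) [^] l" using i j s by simp
  also have "\<dots> = c [^] (j * l)" using assms by (simp add: nat_pow_pow)
  finally show ?thesis by blast
qed

lemma nonsquare_mult_nonsquare:
  assumes "x \<in> center" "x \<notin> center_squares" "y \<in> center" "y \<notin> center_squares"
  shows "x \<otimes> y \<in> center_squares"
proof -
  obtain i :: nat where i: "y = x [^] i" using center_generated_by_nonsquare assms by blast
  have xy: "x \<otimes> y = x [^] Suc i" using assms i by (simp flip: nat_pow_Suc2)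
  have "odd i"
  proof
    assume "even i"
    then have "i div 2 + i div 2 = i" by presburger
    then have "y = x [^] (i div 2) \<otimes> x [^] (i div 2)" using assms i by (simp add: nat_pow_mult)
    then show False using center_squaresI[of "x [^] (i div 2)"] assms by auto
  qed
  then have "Suc i div 2 + Suc i div 2 = Suc i" by presburger
  then have "x \<otimes> y = x [^] (Suc i div 2) \<otimes> x [^] (Suc i div 2)"
    unfolding xy using assms by (simp add: nat_pow_mult del: nat_pow_Suc)
  then show ?thesis using center_squaresI[of "x [^] (Suc i div 2)"] assms by auto
qed

section \<open>Elements with central square and their commutators\<close>

definition square_central :: "'a set" where
  "square_central = {g \<in> carrier G. g \<otimes> g \<in> center}"

lemma square_centralD:
  assumes "u \<in> square_central"
  shows "u \<in> carrier G" "u \<otimes> u \<in> center"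
  using assms by (auto simp: square_central_def)

text \<open>By bilinearity [x, u]^2 = [x, u^2] = 1, and the center has only one involution. Hence
  each u in \<open>square_central\<close> defines a character, trivial exactly for central
  u.\<close>

lemma commutator_square_central:
  assumes "u \<in> square_central" "x \<in> carrier G"
  shows "commutator G x u = \<one> \<or> commutator G x u = \<zeta>"
proof (rule \<zeta>_unique)
  show "commutator G x u \<otimes> commutator G x u = \<one>"
    using square_centralD[OF assms(1)] assms(2) commutator_mult_right[of u u x] by simp
qed (use square_centralD[OF assms(1)] assms(2) in simp)

lemma square_centralI:
  assumes "u \<in> carrier G"
    "\<And>x. x \<in> carrier G \<Longrightarrow> commutator G x u = \<one> \<or> commutator G x u = \<zeta>"
  shows "u \<in> square_central"
proof -
  have "commutator G x (u \<otimes> u) = \<one>" if "x \<in> carrier G" for x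
    using assms(2)[OF that] that assms(1) \<zeta> by (auto simp: commutator_mult_right)
  then have "u \<otimes> u \<in> center" using assms(1) m_closed unfolding center_iff_commutator by blast
  then show ?thesis using assms(1) by (simp add: square_central_def)
qed

lemma square_central_mult:
  assumes "u \<in> square_central" "v \<in> square_central"
  shows "u \<otimes> v \<in> square_central"
proof (rule square_centralI)
  fix x assume "x \<in> carrier G"
  then show "commutator G x (u \<otimes> v) = \<one> \<or> commutator G x (u \<otimes> v) = \<zeta>"
    using commutator_square_central[OF assms(1), of x] commutator_square_central[OF assms(2), of x] \<zeta>
      square_centralD[OF assms(1)] square_centralD[OF assms(2)]
    by (auto simp: commutator_mult_right)
qed (use square_centralD[OF assms(1)] square_centralD[OF assms(2)] in simp)

lemma center_square_central: "t \<in> center \<Longrightarrow> t \<in> square_central"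
  by (rule square_centralI) auto

lemma inv_\<zeta>: "inv \<zeta> = \<zeta>"
  using \<zeta> inv_equality[of \<zeta> \<zeta>] by auto

lemma commutator_square_central_left:
  assumes "u \<in> square_central" "x \<in> carrier G"
  shows "commutator G u x = commutator G x u"
  using commutator_square_central[OF assms] square_centralD[OF assms(1)] assms(2) inv_\<zeta>
    commutator_inv[of x u] by auto

lemma square_central_character:
  assumes "u \<in> square_central"
  shows "binary_character G (\<lambda>x. commutator G x u \<noteq> \<one>)"
  unfolding binary_character_def
proof (intro ballI)
  fix x y assume "x \<in> carrier G" "y \<in> carrier G"
  then show "(commutator G (x \<otimes> y) u \<noteq> \<one>) = ((commutator G x u \<noteq> \<one>) \<noteq> (commutator G y u \<noteq> \<one>))"
    using commutator_square_central[OF assms, of x] commutator_square_central[OF assms, of y] \<zeta>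
      square_centralD[OF assms]
    by (auto simp: commutator_mult_left)
qed

text \<open>A square moves across the bilinear commutator: [c, x^2] = [c^2, x] = 1.\<close>

lemma square_central_squares_commute:
  assumes "c \<in> square_central" "s \<in> squares_mod_center"
  shows "commutator G c s = \<one>"
proof -
  obtain x t where s: "x \<in> carrier G" "t \<in> center" "s = x \<otimes> x \<otimes> t"
    using assms(2) by (rule squares_mod_centerE)
  have "commutator G c s = commutator G c x \<otimes> commutator G c x"
    using s square_centralD[OF assms(1)] by (simp add: commutator_mult_right)
  also have "\<dots> = commutator G (c \<otimes> c) x"
    using s square_centralD[OF assms(1)] by (intro commutator_mult_left[symmetric])
  finally show ?thesis using square_centralD[OF assms(1)] s by simp
qed

text \<open>Otherwise \<open>x \<mapsto> u^\<chi>(x) \<zeta>^\<psi>(x)\<close>, with \<open>\<chi>(x)\<close> recording \<open>[x, u]\<close>, is a derivation because \<open>u\<^sup>2 = \<zeta>\<close>;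
  the factor \<open>\<zeta>^\<psi>(x)\<close> with \<open>\<psi>(u) = 1\<close> turns the resulting automorphism into an involution.\<close>

lemma square_central_square_ne_\<zeta>:
  assumes u: "u \<in> square_central" "u \<notin> squares_mod_center"
  shows "u \<otimes> u \<noteq> \<zeta>"
proof
  assume uu: "u \<otimes> u = \<zeta>"
  have uG: "u \<in> carrier G" using square_centralD[OF u(1)] by simp
  obtain \<psi> where \<psi>: "binary_character G \<psi>" "\<psi> u"
    using binary_character_exists[OF fin uG u(2)] by blast
  define \<chi> where "\<chi> x \<longleftrightarrow> commutator G x u \<noteq> \<one>" for x
  have \<chi>: "binary_character G \<chi>"
    unfolding \<chi>_def[abs_def] by (rule square_central_character[OF u(1)])
  have no: "\<not> \<psi> \<zeta>" "\<not> \<chi> \<zeta>" "\<not> \<psi> \<one>" "\<not> \<chi> \<one>" "\<not> \<chi> u"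
    using binary_character_involution \<psi> \<chi> \<zeta> binary_character_one uG
    by (auto simp: \<chi>_def)
  define \<delta> where "\<delta> x = (if \<chi> x then u else \<one>) \<otimes> (if \<psi> x then \<zeta> else \<one>)" for x
  have z: "\<zeta> \<in> carrier G" using \<zeta> by simp
  have cu: "commutator G u y = (if \<chi> y then \<zeta> else \<one>)" if "y \<in> carrier G" for y
    using commutator_square_central[OF u(1) that] commutator_square_central_left[OF u(1) that]
    by (auto simp: \<chi>_def)
  have c\<delta>: "commutator G (\<delta> x) y = (if \<chi> x \<and> \<chi> y then \<zeta> else \<one>)"
    if "x \<in> carrier G" "y \<in> carrier G" for x y
    using that uG z \<zeta> cu[OF that(2)] by (auto simp: \<delta>_def commutator_mult_left)
  have rules: "\<zeta> \<otimes> u = u \<otimes> \<zeta>" "u \<otimes> (u \<otimes> x) = \<zeta> \<otimes> x" "\<zeta> \<otimes> (u \<otimes> x) = u \<otimes> (\<zeta> \<otimes> x)"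
    "\<zeta> \<otimes> (\<zeta> \<otimes> x) = x" if "x \<in> carrier G" for x
    using that uG z uu center_commute[of \<zeta> u] \<zeta> by (simp_all flip: m_assoc)
  have "\<exists>g\<in>carrier G. \<forall>x\<in>carrier G. \<delta> x = commutator G x g"
  proof (rule derivation_inner)
    fix x assume x: "x \<in> carrier G"
    show "\<delta> x \<in> carrier G" using uG z by (simp add: \<delta>_def)
    have "\<chi> (x \<otimes> \<delta> x) = \<chi> x" "\<psi> (x \<otimes> \<delta> x) = (\<psi> x \<noteq> \<chi> x)"
      using x uG z \<chi> \<psi> no by (auto simp: \<delta>_def binary_character_mult)
    then show "\<delta> x \<otimes> \<delta> (x \<otimes> \<delta> x) = \<one>"
      using uG z uu \<zeta> rules by (auto simp: \<delta>_def m_assoc)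
    show "\<delta> x = \<one>" if "\<forall>\<chi>. binary_character G \<chi> \<longrightarrow> \<not> \<chi> x"
      using spec[OF that, of \<chi>] spec[OF that, of \<psi>] \<chi> \<psi> by (simp add: \<delta>_def)
    fix y assume y: "y \<in> carrier G"
    show "\<delta> (x \<otimes> y) = \<delta> x \<otimes> commutator G (\<delta> x) y \<otimes> \<delta> y"
      unfolding c\<delta>[OF x y]
      using x y uG z uu \<zeta> rules \<chi> \<psi> by (simp add: \<delta>_def m_assoc binary_character_mult)
  qed
  then obtain g where g: "g \<in> carrier G" "\<forall>x\<in>carrier G. \<delta> x = commutator G x g" by blast
  have "u \<notin> center" using u center_subset_squares by blast
  then obtain x where x: "x \<in> carrier G" "\<chi> x" using uG unfolding \<chi>_def center_iff_commutator by blast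
  have d: "\<delta> x \<in> center" using g x by simp
  have "u = \<delta> x \<or> u = \<delta> x \<otimes> \<zeta>" using x uG z \<zeta> by (auto simp: \<delta>_def m_assoc)
  then show False using d \<zeta> \<open>u \<notin> center\<close> by auto
qed

text \<open>If e^2 = s^2 with s central, then e s^(-1) w has square \<open>\<zeta>\<close> and is
  still outside \<open>G^2 Z\<close>, against the previous lemma.\<close>

lemma square_central_mult_square_ne:
  assumes e: "e \<in> square_central" "e \<notin> squares_mod_center"
    and w: "w \<in> center" "w \<otimes> w = \<zeta>"
  shows "e \<otimes> e \<notin> center_squares"
proof
  assume "e \<otimes> e \<in> center_squares"
  then obtain s where s: "s \<in> center" "e \<otimes> e = s \<otimes> s" by (auto simp: center_squares_def)
  have eG: "e \<in> carrier G" using square_centralD e by simp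
  define t where "t = inv s \<otimes> w"
  have t: "t \<in> center" using s w by (simp add: t_def)
  have "t \<otimes> t = inv s \<otimes> inv s \<otimes> \<zeta>" using s w mult_square_central[of "inv s" w] by (simp add: t_def)
  then have "e \<otimes> t \<otimes> (e \<otimes> t) = s \<otimes> s \<otimes> (inv s \<otimes> inv s \<otimes> \<zeta>)"
    using t eG s by (simp add: mult_square_central)
  also have "\<dots> = \<zeta>" using s \<zeta> by (simp add: m_assoc inv_cancel)
  finally have "e \<otimes> t \<otimes> (e \<otimes> t) = \<zeta>" .
  moreover have "e \<otimes> t \<in> square_central" using e t by (simp add: square_central_mult center_square_central)
  moreover have "e \<otimes> t \<notin> squares_mod_center"
  proof
    assume "e \<otimes> t \<in> squares_mod_center"
    then have "e \<otimes> t \<otimes> inv t \<in> squares_mod_center"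
      using t subgroup.m_closed[OF subgroup_squares_mod_center] center_subset_squares by simp
    then show False using e eG t by (simp add: m_assoc)
  qed
  ultimately show False using square_central_square_ne_\<zeta> by blast
qed

text \<open>A counterexample c has a partner d with [c, d] = \<open>\<zeta>\<close>. Neither d nor c
  d commutes with c, so both are counterexamples too, and (c d)^2 = c^2 d^2 \<open>\<zeta>\<close>
  is incompatible with the restrictions on the three squares.\<close>

lemma square_central_subset_squares:
  assumes c: "c \<in> square_central"
  shows "c \<in> squares_mod_center"
proof (rule ccontr)
  assume cS: "c \<notin> squares_mod_center"
  have cG: "c \<in> carrier G" using square_centralD c by simp
  obtain \<psi> where \<psi>: "binary_character G \<psi>" "\<psi> c" using binary_character_exists[OF fin cG cS] by blast
  obtain d where d: "d \<in> carrier G" "\<forall>x\<in>carrier G. commutator G x d = (if \<psi> x then \<zeta> else \<one>)"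
    using binary_character_inner[OF \<psi>(1) \<zeta>(1,2)] by blast
  have dC: "d \<in> square_central" by (rule square_centralI) (use d in auto)
  have cd: "commutator G c d = \<zeta>" using d \<psi> cG by simp
  have dS: "d \<notin> squares_mod_center"
    using square_central_squares_commute[OF c, of d] cd \<zeta> by auto
  have "commutator G c (c \<otimes> d) = \<zeta>" using cd cG d \<zeta> by (simp add: commutator_mult_right)
  then have cdS: "c \<otimes> d \<notin> squares_mod_center"
    using square_central_squares_commute[OF c, of "c \<otimes> d"] \<zeta> by auto
  have cdC: "c \<otimes> d \<in> square_central" using c dC by (rule square_central_mult)
  have "commutator G d c = \<zeta>" using cd commutator_square_central_left[OF c d(1)] by simp
  then have sq: "c \<otimes> d \<otimes> (c \<otimes> d) = c \<otimes> c \<otimes> (d \<otimes> d) \<otimes> \<zeta>" using cG d by (simp add: mult_square)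
  have cc: "c \<otimes> c \<in> center" "d \<otimes> d \<in> center" using square_centralD c dC by auto
  show False
  proof (cases "\<exists>w\<in>center. w \<otimes> w = \<zeta>")
    case True
    then obtain w where w: "w \<in> center" "w \<otimes> w = \<zeta>" by blast
    note ne = square_central_mult_square_ne[OF _ _ w]
    \<comment> \<open>Here all three squares are nonsquares in the center, but the product of two
      nonsquares and the square \<open>\<zeta>\<close> is a square.\<close>
    have "c \<otimes> c \<otimes> (d \<otimes> d) \<in> center_squares"
      using cc ne[OF c cS] ne[OF dC dS] by (intro nonsquare_mult_nonsquare)
    moreover have "\<zeta> \<in> center_squares" using w center_squaresI by fastforce
    ultimately have "c \<otimes> d \<otimes> (c \<otimes> d) \<in> center_squares" unfolding sq by (rule center_squares_mult)
    then show False using ne[OF cdC cdS] by blast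
  next
    case False
    \<comment> \<open>If \<open>\<zeta>\<close> has no central square root, the center is {1,
      \<open>\<zeta>\<close>}. Then c^2 and d^2, not being \<open>\<zeta>\<close>, are trivial, and
      (c d)^2 is the forbidden \<open>\<zeta>\<close>.\<close>
    have small: "t = \<one> \<or> t = \<zeta>" if t: "t \<in> center" for t
    proof (rule disjCI)
      assume "t \<noteq> \<zeta>"
      show "t = \<one>"
      proof (rule ccontr)
        assume "t \<noteq> \<one>"
        then obtain k where k: "t [^] ((2::nat) ^ k) \<noteq> \<one>" "t [^] ((2::nat) ^ k) \<otimes> t [^] ((2::nat) ^ k) = \<one>"
          using power_is_involution[of t] t center_closed by blast
        then have k\<zeta>: "t [^] ((2::nat) ^ k) = \<zeta>" using \<zeta>_unique t center_pow by blast
        then have "k \<noteq> 0" using t \<open>t \<noteq> \<zeta>\<close> by (intro notI) simp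
        then obtain l where "k = Suc l" by (cases k) auto
        then show False using False k\<zeta> power_pow_two[of t l] t by auto
      qed
    qed
    have "c \<otimes> c = \<one>" "d \<otimes> d = \<one>"
      using small cc square_central_square_ne_\<zeta> c cS dC dS by blast+
    then have "c \<otimes> d \<otimes> (c \<otimes> d) = \<zeta>" using sq \<zeta> by simp
    then show False using square_central_square_ne_\<zeta>[OF cdC cdS] by blast
  qed
qed

lemma square_central_commute:
  "c \<in> square_central \<Longrightarrow> d \<in> square_central \<Longrightarrow> commutator G c d = \<one>"
  using square_central_subset_squares square_central_squares_commute by blast

lemma square_central_commute':
  "c \<in> square_central \<Longrightarrow> d \<in> square_central \<Longrightarrow> c \<otimes> d = d \<otimes> c"
  using square_central_commute commutator_eq_one_iff square_centralD by blast

section \<open>The order of \<open>C/Z\<close>\<close>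

lemma nontrivial_character_pair:
  obtains \<chi> y where "binary_character G \<chi>" "y \<in> carrier G" "\<chi> y"
proof -
  obtain y where y: "y \<in> carrier G" "y \<notin> squares_mod_center"
    using squares_mod_center_proper by blast
  then show thesis using binary_character_exists[OF fin y] that by blast
qed

text \<open>An element h realizing a character lies in \<open>square_central\<close>, hence equals
  x^2 t; where the character is nontrivial, \<open>\<zeta>\<close> = [y, h] = [y, x]^2.\<close>

lemma \<zeta>_square: "\<exists>w\<in>center. w \<otimes> w = \<zeta>"
proof -
  obtain \<chi> y where \<chi>: "binary_character G \<chi>" "y \<in> carrier G" "\<chi> y"
    by (rule nontrivial_character_pair)
  obtain h where h: "h \<in> carrier G" "\<forall>x\<in>carrier G. commutator G x h = (if \<chi> x then \<zeta> else \<one>)"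
    using binary_character_inner[OF \<chi>(1) \<zeta>(1,2)] by blast
  have "h \<in> square_central" by (rule square_centralI) (use h in auto)
  then have "h \<in> squares_mod_center" by (rule square_central_subset_squares)
  then obtain x t where x: "x \<in> carrier G" "t \<in> center" "h = x \<otimes> x \<otimes> t" by (rule squares_mod_centerE)
  have "commutator G y h = commutator G y x \<otimes> commutator G y x"
    using x \<chi> by (simp add: commutator_mult_right)
  then show ?thesis using h(2) \<chi> x by (intro bexI[of _ "commutator G y x"]) auto
qed

text \<open>The derivation is \<open>x \<mapsto> u^\<psi>(x) v^\<chi>(x) \<zeta>^(\<chi>(x)\<psi>(x))\<close>, where \<open>\<chi>\<close> and \<open>\<psi>\<close> record \<open>[x, u]\<close> and \<open>[x, v]\<close>. The
  interchange of \<open>u\<close> and \<open>v\<close> makes its cocycle defect the polarization of the quadratic form \<open>\<chi>\<psi>\<close>.\<close>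

lemma no_two_involutions:
  assumes u: "u \<in> square_central" "u \<otimes> u = \<one>" and v: "v \<in> square_central" "v \<otimes> v = \<one>"
    and ne: "u \<notin> center" "v \<notin> center" "u \<otimes> v \<notin> center"
  shows False
proof -
  have G: "u \<in> carrier G" "v \<in> carrier G" "\<zeta> \<in> carrier G" using square_centralD u v \<zeta> by auto
  define \<chi> where "\<chi> x \<longleftrightarrow> commutator G x u \<noteq> \<one>" for x
  define \<psi> where "\<psi> x \<longleftrightarrow> commutator G x v \<noteq> \<one>" for x
  have \<chi>: "binary_character G \<chi>"
    unfolding \<chi>_def[abs_def] by (rule square_central_character[OF u(1)])
  have \<psi>: "binary_character G \<psi>"
    unfolding \<psi>_def[abs_def] by (rule square_central_character[OF v(1)])
  have no: "\<not> \<psi> \<zeta>" "\<not> \<chi> \<zeta>" "\<not> \<psi> \<one>" "\<not> \<chi> \<one>" "\<not> \<chi> u" "\<not> \<psi> v" "\<not> \<chi> v" "\<not> \<psi> u"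
    using binary_character_involution \<psi> \<chi> \<zeta> binary_character_one G
      square_central_commute[OF u(1) v(1)] square_central_commute[OF v(1) u(1)]
    by (auto simp: \<chi>_def \<psi>_def)
  define \<delta> where "\<delta> x = (if \<psi> x then u else \<one>) \<otimes>
      ((if \<chi> x then v else \<one>) \<otimes> (if \<chi> x \<and> \<psi> x then \<zeta> else \<one>))" for x
  have cu: "commutator G u y = (if \<chi> y then \<zeta> else \<one>)" if "y \<in> carrier G" for y
    using commutator_square_central[OF u(1) that] commutator_square_central_left[OF u(1) that]
    by (auto simp: \<chi>_def)
  have cv: "commutator G v y = (if \<psi> y then \<zeta> else \<one>)" if "y \<in> carrier G" for y
    using commutator_square_central[OF v(1) that] commutator_square_central_left[OF v(1) that]
    by (auto simp: \<psi>_def)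
  have c\<delta>: "commutator G (\<delta> x) y = (if (\<psi> x \<and> \<chi> y) \<noteq> (\<chi> x \<and> \<psi> y) then \<zeta> else \<one>)"
    if "x \<in> carrier G" "y \<in> carrier G" for x y
    using that G \<zeta> cu[OF that(2)] cv[OF that(2)] by (simp add: \<delta>_def commutator_mult_left)
  have vu: "v \<otimes> u = u \<otimes> v" using square_central_commute' u v by simp
  have rules: "\<zeta> \<otimes> u = u \<otimes> \<zeta>" "\<zeta> \<otimes> v = v \<otimes> \<zeta>" "u \<otimes> (u \<otimes> x) = x" "v \<otimes> (v \<otimes> x) = x"
    "\<zeta> \<otimes> (\<zeta> \<otimes> x) = x" "\<zeta> \<otimes> (u \<otimes> x) = u \<otimes> (\<zeta> \<otimes> x)" "\<zeta> \<otimes> (v \<otimes> x) = v \<otimes> (\<zeta> \<otimes> x)"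
    "v \<otimes> (u \<otimes> x) = u \<otimes> (v \<otimes> x)"
    if "x \<in> carrier G" for x
    using that G u v vu center_commute[of \<zeta> u] center_commute[of \<zeta> v] \<zeta>
    by (simp_all flip: m_assoc)
  have "\<exists>g\<in>carrier G. \<forall>x\<in>carrier G. \<delta> x = commutator G x g"
  proof (rule derivation_inner)
    fix x assume x: "x \<in> carrier G"
    show "\<delta> x \<in> carrier G" using G by (simp add: \<delta>_def)
    have "\<chi> (x \<otimes> \<delta> x) = \<chi> x" "\<psi> (x \<otimes> \<delta> x) = \<psi> x"
      using x G \<chi> \<psi> no by (auto simp: \<delta>_def binary_character_mult)
    then show "\<delta> x \<otimes> \<delta> (x \<otimes> \<delta> x) = \<one>"
      using G u v \<zeta> rules vu by (auto simp: \<delta>_def m_assoc)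
    show "\<delta> x = \<one>" if "\<forall>\<chi>. binary_character G \<chi> \<longrightarrow> \<not> \<chi> x"
      using spec[OF that, of \<chi>] spec[OF that, of \<psi>] \<chi> \<psi> by (simp add: \<delta>_def)
    fix y assume y: "y \<in> carrier G"
    show "\<delta> (x \<otimes> y) = \<delta> x \<otimes> commutator G (\<delta> x) y \<otimes> \<delta> y"
      unfolding c\<delta>[OF x y] unfolding \<delta>_def binary_character_mult[OF \<chi> x y] binary_character_mult[OF \<psi> x y]
      using G u(2) v(2) \<zeta> rules vu
      by (cases "\<chi> x"; cases "\<psi> x"; cases "\<chi> y"; cases "\<psi> y"; simp add: m_assoc)
  qed
  then obtain g where g: "g \<in> carrier G" "\<forall>x\<in>carrier G. \<delta> x = commutator G x g" by blast
  \<comment> \<open>At such an x the derivation takes the value u or u v \<open>\<zeta>\<close>, and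
    neither is central.\<close>
  obtain x where x: "x \<in> carrier G" "\<psi> x"
    using ne G unfolding \<psi>_def center_iff_commutator by blast
  have d: "\<delta> x \<in> center" using g x by simp
  show False
  proof (cases "\<chi> x")
    case True
    have "u \<otimes> v = \<delta> x \<otimes> \<zeta>" using x True G \<zeta> by (simp add: \<delta>_def m_assoc)
    then show False using d \<zeta> ne by auto
  next
    case False
    then have "u = \<delta> x" using x G by (simp add: \<delta>_def)
    then show False using d ne by auto
  qed
qed

text \<open>Dividing u and v by central square roots of their squares gives elements of order
  dividing 2, to which the previous lemma applies. So the u in question fill at most one nontrivial
  coset of the center.\<close>

lemma square_central_square_rank:
  assumes u: "u \<in> square_central" "u \<otimes> u \<in> center_squares"
    and v: "v \<in> square_central" "v \<otimes> v \<in> center_squares"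
  shows "u \<in> center \<or> v \<in> center \<or> u \<otimes> v \<in> center"
proof (rule ccontr)
  assume ne: "\<not> ?thesis"
  obtain s t where s: "s \<in> center" "u \<otimes> u = s \<otimes> s" and t: "t \<in> center" "v \<otimes> v = t \<otimes> t"
    using u v by (auto simp: center_squares_def)
  have G: "u \<in> carrier G" "v \<in> carrier G" using square_centralD u v by auto
  have cancel: "x \<in> center" if "x \<otimes> y \<in> center" "x \<in> carrier G" "y \<in> center" for x y
  proof -
    have "x \<otimes> y \<otimes> inv y \<in> center" using that by blast
    then show ?thesis using that by (simp add: m_assoc)
  qed
  show False
  proof (rule no_two_involutions[of "u \<otimes> inv s" "v \<otimes> inv t"])
    show "u \<otimes> inv s \<otimes> (u \<otimes> inv s) = \<one>" "v \<otimes> inv t \<otimes> (v \<otimes> inv t) = \<one>"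
      unfolding mult_square_central[OF G(1) center_inv[OF s(1)]]
        mult_square_central[OF G(2) center_inv[OF t(1)]] s(2) t(2)
      using s t by (simp_all add: m_assoc inv_cancel)
    show "u \<otimes> inv s \<in> square_central" "v \<otimes> inv t \<in> square_central"
      using u v s t by (simp_all add: square_central_mult center_square_central)
    show "u \<otimes> inv s \<notin> center" "v \<otimes> inv t \<notin> center"
      using ne cancel G s t by blast+
    have "u \<otimes> inv s \<otimes> (v \<otimes> inv t) = u \<otimes> v \<otimes> (inv s \<otimes> inv t)"
      using G s t center_commute[of "inv s" "v \<otimes> inv t"] center_commute[of "inv s" "inv t"] by (simp add: m_assoc)
    then show "u \<otimes> inv s \<otimes> (v \<otimes> inv t) \<notin> center"
      using ne cancel[of "u \<otimes> v" "inv s \<otimes> inv t"] G s t by auto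
  qed
qed

text \<open>Modulo the center, \<open>square_central\<close> is generated by c and d. Multiplying by
  c where necessary moves d and g to elements e and f with squares in \<open>center_squares\<close>;
  the rank bound then makes f central or congruent to e.\<close>

lemma square_central_coset_cases:
  assumes c: "c \<in> square_central" "c \<otimes> c \<notin> center_squares"
    and d: "d \<in> square_central" "d \<notin> center" "d \<otimes> c \<notin> center"
    and g: "g \<in> square_central"
    and x: "x \<in> carrier G" "commutator G x c = \<one>" "commutator G x d = \<one>"
  shows "commutator G x g = \<one>"
proof -
  have G: "c \<in> carrier G" "d \<in> carrier G" "g \<in> carrier G" using square_centralD c d g by auto
  have sq: "e \<otimes> c \<otimes> (e \<otimes> c) \<in> center_squares" if "e \<in> square_central" "e \<otimes> e \<notin> center_squares" for e
  proof -
    have "e \<otimes> c \<otimes> (e \<otimes> c) = e \<otimes> e \<otimes> (c \<otimes> c)"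
      using mult_square[of e c] square_central_commute[OF c(1) that(1)] square_centralD[OF that(1)] G by simp
    then show ?thesis using nonsquare_mult_nonsquare that c square_centralD by simp
  qed
  have "\<exists>e. e \<in> square_central \<and> e \<otimes> e \<in> center_squares \<and> e \<notin> center \<and> commutator G x e = \<one>"
  proof (cases "d \<otimes> d \<in> center_squares")
    case True
    then show ?thesis using d x by blast
  next
    case False
    then show ?thesis using sq[OF d(1)] square_central_mult[OF d(1) c(1)] d x G
      by (intro exI[of _ "d \<otimes> c"]) (simp add: commutator_mult_right)
  qed
  then obtain e where e: "e \<in> square_central" "e \<otimes> e \<in> center_squares" "e \<notin> center" "commutator G x e = \<one>"
    by blast
  have main: "commutator G x f = \<one>" if f: "f \<in> square_central" "f \<otimes> f \<in> center_squares" for f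
  proof -
    consider "f \<in> center" | "f \<otimes> e \<in> center"
      using square_central_square_rank[OF f e(1,2)] e by blast
    then show ?thesis
    proof cases
      case 2
      then have "commutator G x (f \<otimes> e) = \<one>" using x by simp
      then show ?thesis using e x f square_centralD[OF e(1)] square_centralD[OF f(1)]
        by (simp add: commutator_mult_right)
    qed (use x in simp)
  qed
  show ?thesis
  proof (cases "g \<otimes> g \<in> center_squares")
    case False
    have "commutator G x (g \<otimes> c) = \<one>"
      by (rule main) (use square_central_mult[OF g c(1)] sq[OF g False] in auto)
    then show ?thesis using x G by (simp add: commutator_mult_right)
  qed (use main g in blast)
qed

text \<open>Otherwise some character is nontrivial at x. It is realized by an element of
  \<open>square_central\<close>, which does not commute with x, against the previous lemma.\<close>

lemma square_central_span:
  assumes c: "c \<in> square_central" "c \<otimes> c \<notin> center_squares"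
    and d: "d \<in> square_central" "d \<notin> center" "d \<otimes> c \<notin> center"
    and x: "x \<in> carrier G" "commutator G x c = \<one>" "commutator G x d = \<one>"
  shows "x \<in> squares_mod_center"
proof (rule ccontr)
  assume "x \<notin> squares_mod_center"
  then obtain \<chi> where \<chi>: "binary_character G \<chi>" "\<chi> x" using binary_character_exists[OF fin x(1)] by blast
  obtain g where g: "g \<in> carrier G" "\<forall>x\<in>carrier G. commutator G x g = (if \<chi> x then \<zeta> else \<one>)"
    using binary_character_inner[OF \<chi>(1) \<zeta>(1,2)] by blast
  have "g \<in> square_central" by (rule square_centralI) (use g in auto)
  then have "commutator G x g = \<one>" by (rule square_central_coset_cases[OF c d _ x])
  then show False using g \<chi> x \<zeta> by simp
qed

text \<open>Otherwise the rank bound would hold throughout \<open>square_central\<close>. But the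
  noncentral power c of h commutes with h, while d is chosen not to, so c, d and c d are all
  noncentral.\<close>

lemma square_central_nonsquare_exists: "\<exists>c\<in>square_central. c \<otimes> c \<notin> center_squares"
proof (rule ccontr)
  assume neg: "\<not> ?thesis"
  have all: "c \<otimes> c \<in> center_squares" if "c \<in> square_central" for c using neg that by blast
  obtain \<chi> y where \<chi>: "binary_character G \<chi>" "y \<in> carrier G" "\<chi> y"
    by (rule nontrivial_character_pair)
  obtain h and k :: nat where h: "h \<in> carrier G" "h \<notin> squares_mod_center"
    "\<forall>x\<in>carrier G. commutator G x h [^] ((2::nat) ^ k) = (if \<chi> x then \<zeta> else \<one>)"
    using character_lift[OF \<chi> \<zeta>] by blast
  define c where "c = h [^] ((2::nat) ^ k)"
  have c: "commutator G x c = (if \<chi> x then \<zeta> else \<one>)" if "x \<in> carrier G" for x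
    using that h by (simp add: c_def commutator_pow_right)
  have cC: "c \<in> square_central" by (rule square_centralI) (use h c in \<open>auto simp: c_def\<close>)
  have ch: "commutator G h c = \<one>" using h by (simp add: c_def commutator_pow_right)
  obtain \<psi> where \<psi>: "binary_character G \<psi>" "\<psi> h" using binary_character_exists[OF fin h(1,2)] by blast
  obtain d where d: "d \<in> carrier G" "\<forall>x\<in>carrier G. commutator G x d = (if \<psi> x then \<zeta> else \<one>)"
    using binary_character_inner[OF \<psi>(1) \<zeta>(1,2)] by blast
  have dC: "d \<in> square_central" by (rule square_centralI) (use d in auto)
  have "c \<notin> center" using c[OF \<chi>(2)] \<chi> \<zeta> by auto
  moreover have "commutator G h d = \<zeta>" using d(2) h \<psi> by simp
  moreover from this have "commutator G h (c \<otimes> d) = \<zeta>"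
    using ch h d square_centralD[OF cC] \<zeta> by (simp add: commutator_mult_right)
  ultimately have "c \<notin> center" "d \<notin> center" "c \<otimes> d \<notin> center" using \<zeta> h by auto
  then show False using square_central_square_rank[OF cC all[OF cC] dC all[OF dC]] by blast
qed

end

section \<open>A pair of metacyclic generators\<close>

context rigid_two_group
begin

text \<open>The last condition expresses through commutators that \<open>a^(2^k)\<close> and \<open>b^(2^k)\<close> generate
  \<open>square_central\<close> modulo the center.\<close>

definition adapted_pair :: "'a \<Rightarrow> 'a \<Rightarrow> nat \<Rightarrow> bool" where
  "adapted_pair a b k \<longleftrightarrow> a \<in> carrier G \<and> b \<in> carrier G \<and> 1 \<le> k \<and>
     a [^] ((2::nat) ^ Suc k) \<in> center \<and> a [^] ((2::nat) ^ Suc k) \<notin> center_squares \<and>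
     b [^] ((2::nat) ^ Suc k) \<in> center \<and>
     commutator G a b [^] ((2::nat) ^ k) = \<zeta> \<and>
     (\<forall>x\<in>carrier G. commutator G x a [^] ((2::nat) ^ k) = \<one> \<longrightarrow>
        commutator G x b [^] ((2::nat) ^ k) = \<one> \<longrightarrow> x \<in> squares_mod_center)"

text \<open>A root of the largest 2-power degree modulo the center cannot lie in
  \<open>G^2 Z\<close>. The degree is bounded because beyond the exponent of G the power vanishes
  and c would be central.\<close>

lemma power_mod_center_maximal:
  assumes c: "c \<in> carrier G" "c \<notin> center"
  obtains a t and k :: nat where "a \<in> carrier G" "a \<notin> squares_mod_center" "t \<in> center"
    "c = a [^] ((2::nat) ^ k) \<otimes> t"
proof -
  define P where "P k \<longleftrightarrow> (\<exists>a\<in>carrier G. \<exists>t\<in>center. c = a [^] ((2::nat) ^ k) \<otimes> t)" for k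
  have P0: "P 0" unfolding P_def using c by (intro bexI[of _ c] bexI[of _ \<one>]) auto
  have bound: "k \<le> m" if P: "P k" for k
  proof (rule ccontr)
    assume "\<not> k \<le> m"
    then have k: "(2::nat) ^ k = 2 ^ m * 2 ^ (k - m)" by (simp flip: power_add)
    obtain a t where a: "a \<in> carrier G" "t \<in> center" "c = a [^] ((2::nat) ^ k) \<otimes> t"
      using P unfolding P_def by blast
    have "a [^] ((2::nat) ^ k) = (a [^] ((2::nat) ^ m)) [^] ((2::nat) ^ (k - m))"
      unfolding k by (rule nat_pow_pow[symmetric]) (use a in simp)
    then have "c = t" using a pow_exponent[of a] by simp
    then show False using a c by simp
  qed
  obtain k where k: "P k" "\<And>j. P j \<Longrightarrow> j \<le> k"
    using GreatestI_nat[of P 0 m] Greatest_le_nat[of P _ m] P0 bound by blast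
  obtain a t where a: "a \<in> carrier G" "t \<in> center" "c = a [^] ((2::nat) ^ k) \<otimes> t"
    using k unfolding P_def by blast
  have "a \<notin> squares_mod_center"
  proof
    assume "a \<in> squares_mod_center"
    then obtain y s where y: "y \<in> carrier G" "s \<in> center" "a = y \<otimes> y \<otimes> s" by (rule squares_mod_centerE)
    have "a [^] ((2::nat) ^ k) = (y [^] (2::nat)) [^] ((2::nat) ^ k) \<otimes> s [^] ((2::nat) ^ k)"
      using y mult_pow_class_two[of "y \<otimes> y" s "2 ^ k"] by simp
    also have "(y [^] (2::nat)) [^] ((2::nat) ^ k) = y [^] ((2::nat) ^ Suc k)"
      using y by (simp only: nat_pow_pow power_Suc)
    finally have "c = y [^] ((2::nat) ^ Suc k) \<otimes> (s [^] ((2::nat) ^ k) \<otimes> t)"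
      using a y by (simp only: a(3)) (simp add: m_assoc)
    then have "P (Suc k)" unfolding P_def using y a by blast
    then have "Suc k \<le> k" by (rule k(2))
    then show False by simp
  qed
  with a show thesis by (intro that)
qed

text \<open>Here a is a maximal root of an element c of \<open>square_central\<close> with nonsquare
  square, and b a lift of a character that is nontrivial at a. The elements c and d, the latter a
  2-power of b, then detect \<open>G^2 Z\<close> by commutators.\<close>

lemma adapted_pair_exists: "\<exists>a b k. adapted_pair a b k"
proof -
  obtain c where c: "c \<in> square_central" "c \<otimes> c \<notin> center_squares"
    using square_central_nonsquare_exists by blast
  have cG: "c \<in> carrier G" using square_centralD c by simp
  have cZ: "c \<notin> center" using c center_squaresI by blast
  obtain a t and k :: nat where a: "a \<in> carrier G" "a \<notin> squares_mod_center" "t \<in> center"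
    "c = a [^] ((2::nat) ^ k) \<otimes> t"
    using power_mod_center_maximal[OF cG cZ] by blast
  \<comment> \<open>Since c lies in \<open>G^2 Z\<close> and a does not, a proper root was
    extracted. This is the source of the bound 2 <= r in the end.\<close>
  have "k \<noteq> 0"
  proof
    assume "k = 0"
    then have "c \<otimes> inv t = a" using a by (simp add: m_assoc)
    moreover have "c \<otimes> inv t \<in> squares_mod_center"
      using square_central_subset_squares[OF c(1)] a center_subset_squares
        subgroup.m_closed[OF subgroup_squares_mod_center] by simp
    ultimately show False using a by simp
  qed
  have ca: "commutator G x a [^] ((2::nat) ^ k) = commutator G x c" if "x \<in> carrier G" for x
    using that a by (simp add: commutator_mult_right commutator_pow_right)
  define A where "A = a [^] ((2::nat) ^ Suc k)"
  have cc: "c \<otimes> c = A \<otimes> (t \<otimes> t)"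
    unfolding A_def a(4) power_pow_two[OF a(1)] using a by (intro mult_square_central) auto
  have "A = c \<otimes> c \<otimes> inv (t \<otimes> t)" unfolding cc using a by (simp add: m_assoc A_def inv_cancel inv_mult_group)
  then have AZ: "A \<in> center" using square_centralD[OF c(1)] a by simp
  have AN: "A \<notin> center_squares"
    using cc c a center_squares_mult center_squaresI by metis
  obtain \<psi> where \<psi>: "binary_character G \<psi>" "\<psi> a" using binary_character_exists[OF fin a(1,2)] by blast
  obtain b and l :: nat where b: "b \<in> carrier G" "b \<notin> squares_mod_center"
    "\<forall>x\<in>carrier G. commutator G x b [^] ((2::nat) ^ l) = (if \<psi> x then \<zeta> else \<one>)"
    using character_lift[OF \<psi>(1) a(1) \<psi>(2) \<zeta>] by blast
  define d where "d = b [^] ((2::nat) ^ l)"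
  have d: "commutator G x d = (if \<psi> x then \<zeta> else \<one>)" if "x \<in> carrier G" for x
    using that b by (simp add: d_def commutator_pow_right)
  have dG: "d \<in> carrier G" using b by (simp add: d_def)
  have dC: "d \<in> square_central" by (rule square_centralI) (use dG d in auto)
  have ad: "commutator G a d = \<zeta>" using d a \<psi> by simp
  have "commutator G a c = \<one>" using ca[OF a(1)] a by simp
  then have "commutator G a (d \<otimes> c) = \<zeta>" using ad a dG cG \<zeta> by (simp add: commutator_mult_right)
  then have dZ: "d \<notin> center" "d \<otimes> c \<notin> center" using ad a \<zeta> by auto
  note span = square_central_span[OF c dC dZ]
  \<comment> \<open>As b already commutes with its power d, commuting with c as well would put b
    into \<open>G^2 Z\<close>.\<close>
  have "commutator G b d = \<one>" using b by (simp add: d_def commutator_pow_right)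
  then have "commutator G b c \<noteq> \<one>" using span[OF b(1)] b by blast
  then have "commutator G b c = \<zeta>" using commutator_square_central[OF c(1) b(1)] by blast
  then have "commutator G b a [^] ((2::nat) ^ k) = \<zeta>" using ca b by simp
  then have "inv (commutator G a b [^] ((2::nat) ^ k)) = \<zeta>"
    using a b by (simp add: nat_pow_inv[symmetric] commutator_inv)
  then have k: "commutator G a b [^] ((2::nat) ^ k) = \<zeta>"
    using inv_\<zeta> a b by (metis commutator_closed inv_inv nat_pow_closed)
  moreover have "commutator G a b [^] ((2::nat) ^ l) = \<zeta>" using b a \<psi> by simp
  \<comment> \<open>Both exponents are read off from the order of the same commutator
    [a, b].\<close>
  ultimately have "l = k" using exponent_zeta_unique[of "commutator G a b" k l] a b by simp
  have "d \<otimes> d = b [^] ((2::nat) ^ Suc k)"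
    unfolding d_def \<open>l = k\<close> using b power_pow_two by simp
  then have "b [^] ((2::nat) ^ Suc k) \<in> center" using square_centralD[OF dC] by simp
  moreover have "x \<in> squares_mod_center"
    if "x \<in> carrier G" "commutator G x a [^] ((2::nat) ^ k) = \<one>" "commutator G x b [^] ((2::nat) ^ k) = \<one>" for x
    by (rule span) (use that ca b in \<open>simp_all add: d_def \<open>l = k\<close> commutator_pow_right\<close>)
  ultimately have "adapted_pair a b k"
    unfolding adapted_pair_def using a(1) b(1) \<open>k \<noteq> 0\<close> AZ AN k unfolding A_def by simp
  then show ?thesis by blast
qed

lemma adapted_pairD:
  assumes "adapted_pair a b k"
  shows "a \<in> carrier G" "b \<in> carrier G" "1 \<le> k"
    "a [^] ((2::nat) ^ Suc k) \<in> center" "a [^] ((2::nat) ^ Suc k) \<notin> center_squares"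
    "b [^] ((2::nat) ^ Suc k) \<in> center"
    "commutator G a b [^] ((2::nat) ^ k) = \<zeta>"
    "\<And>x. x \<in> carrier G \<Longrightarrow> commutator G x a [^] ((2::nat) ^ k) = \<one> \<Longrightarrow>
      commutator G x b [^] ((2::nat) ^ k) = \<one> \<Longrightarrow> x \<in> squares_mod_center"
  using assms unfolding adapted_pair_def by blast+

lemma choose_two_power: "2 ^ Suc k choose 2 = 2 ^ k * (2 ^ Suc k - 1)"
  by (simp add: choose_two)

text \<open>The collected commutators have exponent i times 2^k (2^(k+1) - 1). Since [a, b]^(2^k) is
  \<open>\<zeta>\<close> and the remaining factor is odd, they contribute exactly
  \<open>\<zeta>\<close>^i.\<close>

lemma adapted_pair_mult_power:
  assumes ab: "adapted_pair a b k"
  shows "(b \<otimes> a [^] (i::nat)) [^] ((2::nat) ^ Suc k)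
      = b [^] ((2::nat) ^ Suc k) \<otimes> (a [^] ((2::nat) ^ Suc k) \<otimes> \<zeta>) [^] i"
    and "(b \<otimes> a [^] (i::nat)) [^] ((2::nat) ^ Suc k) = \<one> \<Longrightarrow> adapted_pair a (b \<otimes> a [^] i) k"
proof -
  note D = adapted_pairD[OF ab]
  let ?q = "(2::nat) ^ Suc k" and ?D = "commutator G a b"
  have "commutator G (a [^] i) b [^] (?q choose 2) = ?D [^] (i * (?q choose 2))"
    using D(1,2) by (simp only: commutator_pow_left nat_pow_pow commutator_closed)
  also have "i * (?q choose 2) = 2 ^ k * ((?q - 1) * i)"
    by (simp only: choose_two_power) simp
  also have "?D [^] (2 ^ k * ((?q - 1) * i)) = (\<zeta> [^] (?q - 1)) [^] i"
    using D(1,2,7) \<zeta>(1) by (simp only: nat_pow_pow[symmetric] commutator_closed center_closed)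
  also have "\<zeta> [^] (?q - 1) = \<zeta>"
  proof -
    have "?q - 1 = Suc (2 * (2 ^ k - 1))" by (cases "(2::nat) ^ k") auto
    then have "\<zeta> [^] (?q - 1) = (\<zeta> [^] (2::nat)) [^] ((2::nat) ^ k - 1) \<otimes> \<zeta>"
      using \<zeta>(1) by (simp only: nat_pow_Suc nat_pow_pow center_closed)
    then show ?thesis using \<zeta> by simp
  qed
  finally have e: "commutator G (a [^] i) b [^] (?q choose 2) = \<zeta> [^] i" .
  have "(b \<otimes> a [^] i) [^] ?q = b [^] ?q \<otimes> (a [^] i) [^] ?q \<otimes> \<zeta> [^] i"
    using D(1,2) mult_pow_class_two[of b "a [^] i" ?q] e by simp
  also have "(a [^] i) [^] ?q = (a [^] ?q) [^] i"
    using D(1,2) by (simp only: nat_pow_pow mult.commute)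
  also have "b [^] ?q \<otimes> (a [^] ?q) [^] i \<otimes> \<zeta> [^] i = b [^] ?q \<otimes> (a [^] ?q \<otimes> \<zeta>) [^] i"
    using D(1,2,4) \<zeta> by (simp add: mult_pow_class_two m_assoc del: power_Suc)
  finally show "(b \<otimes> a [^] i) [^] ?q = b [^] ?q \<otimes> (a [^] ?q \<otimes> \<zeta>) [^] i" .
  assume 1: "(b \<otimes> a [^] i) [^] ?q = \<one>"
  have cx: "commutator G x (b \<otimes> a [^] i) [^] ((2::nat) ^ k)
      = commutator G x b [^] ((2::nat) ^ k) \<otimes> (commutator G x a [^] ((2::nat) ^ k)) [^] i"
    if "x \<in> carrier G" for x
  proof -
    have "commutator G x (b \<otimes> a [^] i) [^] ((2::nat) ^ k)
      = commutator G x b [^] ((2::nat) ^ k) \<otimes> (commutator G x a [^] i) [^] ((2::nat) ^ k)"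
      using that D(1,2) by (simp add: commutator_mult_right commutator_pow_right mult_pow_class_two)
    also have "(commutator G x a [^] i) [^] ((2::nat) ^ k) = (commutator G x a [^] ((2::nat) ^ k)) [^] i"
      using that D(1,2) by (simp add: nat_pow_pow mult.commute)
    finally show ?thesis .
  qed
  show "adapted_pair a (b \<otimes> a [^] i) k"
    unfolding adapted_pair_def 1
  proof (intro conjI ballI impI)
    show "commutator G a (b \<otimes> a [^] i) [^] ((2::nat) ^ k) = \<zeta>"
      using D(1,2,7) cx[of a] \<zeta> by simp
    fix x assume x: "x \<in> carrier G" "commutator G x a [^] ((2::nat) ^ k) = \<one>"
      "commutator G x (b \<otimes> a [^] i) [^] ((2::nat) ^ k) = \<one>"
    show "x \<in> squares_mod_center"
      by (rule D(8)) (use x D(1,2) cx[OF x(1)] in simp_all)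
  qed (use D(1-6) in auto)
qed

text \<open>As \<open>\<zeta>\<close> is a square in the center, multiplying the generator
  a^(2^(k+1)) by it yields a generator again; a suitable power cancels b^(2^(k+1)).\<close>

lemma adapted_pair_order_right:
  obtains a b k where "adapted_pair a b k" "b [^] ((2::nat) ^ Suc k) = \<one>"
proof -
  obtain a b k where ab: "adapted_pair a b k" using adapted_pair_exists by metis
  note D = adapted_pairD[OF ab]
  let ?q = "(2::nat) ^ Suc k"
  let ?A = "a [^] ?q \<otimes> \<zeta>"
  obtain w where w: "w \<in> center" "w \<otimes> w = \<zeta>" using \<zeta>_square by blast
  then have \<zeta>sq: "\<zeta> \<in> center_squares" using center_squaresI[of w] by simp
  have "?A \<notin> center_squares"
  proof
    assume "?A \<in> center_squares"
    then have "?A \<otimes> inv \<zeta> \<in> center_squares"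
      using \<zeta>sq center_squares_inv center_squares_mult by blast
    then show False using D(1,5) \<zeta> by (simp add: m_assoc del: power_Suc)
  qed
  then obtain i :: nat where i: "inv (b [^] ?q) = ?A [^] i"
    using center_generated_by_nonsquare[of ?A "inv (b [^] ?q)"] D(4,6) \<zeta>(1) by blast
  have "(b \<otimes> a [^] i) [^] ?q = \<one>"
    unfolding adapted_pair_mult_power(1)[OF ab] i[symmetric] using D(2) by simp
  moreover from this have "adapted_pair a (b \<otimes> a [^] i) k" by (rule adapted_pair_mult_power(2)[OF ab])
  ultimately show thesis using that by blast
qed

text \<open>Odd powers fix \<open>\<zeta>\<close> and are invertible, so the commutator conditions
  on b survive.\<close>

lemma adapted_pair_odd_power:
  fixes j :: nat
  assumes ab: "adapted_pair a b k" and j: "odd j" and b: "b [^] ((2::nat) ^ Suc k) = \<one>"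
  shows "adapted_pair a (b [^] j) k" "(b [^] j) [^] ((2::nat) ^ Suc k) = \<one>"
proof -
  note D = adapted_pairD[OF ab]
  have "(b [^] j) [^] ((2::nat) ^ Suc k) = (b [^] ((2::nat) ^ Suc k)) [^] j"
    using D(1,2) by (simp only: nat_pow_pow mult.commute)
  then show 1: "(b [^] j) [^] ((2::nat) ^ Suc k) = \<one>" using b by simp
  have cx: "commutator G x (b [^] j) [^] ((2::nat) ^ k) = (commutator G x b [^] ((2::nat) ^ k)) [^] j"
    if "x \<in> carrier G" for x
    using that D(1,2) by (simp add: commutator_pow_right nat_pow_pow mult.commute)
  have \<zeta>j: "\<zeta> [^] j = \<zeta>"
  proof -
    obtain p where "j = Suc (2 * p)" using j oddE by (metis Suc_eq_plus1)
    then have "\<zeta> [^] j = (\<zeta> [^] (2::nat)) [^] p \<otimes> \<zeta>"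
      using \<zeta>(1) by (simp only: nat_pow_Suc nat_pow_pow center_closed)
    then show ?thesis using \<zeta> by simp
  qed
  show "adapted_pair a (b [^] j) k"
    unfolding adapted_pair_def 1
  proof (intro conjI ballI impI)
    show "commutator G a (b [^] j) [^] ((2::nat) ^ k) = \<zeta>" using D(1,2,7) cx[of a] \<zeta>j by simp
    fix x assume x: "x \<in> carrier G" "commutator G x a [^] ((2::nat) ^ k) = \<one>"
      "commutator G x (b [^] j) [^] ((2::nat) ^ k) = \<one>"
    obtain p where p: "\<And>y. y \<in> carrier G \<Longrightarrow> (y [^] j) [^] (p::nat) = y" using odd_root[OF j] by blast
    have 2: "(commutator G x b [^] ((2::nat) ^ k)) [^] j = \<one>" using cx[OF x(1)] x(3) by simp
    have "commutator G x b [^] ((2::nat) ^ k) = ((commutator G x b [^] ((2::nat) ^ k)) [^] j) [^] p"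
      using x(1) D(2) by (intro p[symmetric]) simp
    then have "commutator G x b [^] ((2::nat) ^ k) = \<one>" unfolding 2 by simp
    then show "x \<in> squares_mod_center" using D(8) x by blast
  qed (use D(1-6) in auto)
qed

text \<open>The set W of products b^j a^i t is closed under multiplication and G = G^2 W. Iterating
  gives x = v^(2^m) w with trivial first factor, and the central t is a power of a.\<close>

lemma adapted_pair_generates:
  assumes ab: "adapted_pair a b k" and x: "x \<in> carrier G"
  shows "\<exists>(i::nat) (j::nat). x = b [^] j \<otimes> a [^] i"
proof -
  note D = adapted_pairD[OF ab]
  let ?q = "(2::nat) ^ Suc k"
  define W where "W = {b [^] (j::nat) \<otimes> a [^] (i::nat) \<otimes> t | i j t. t \<in> center}"
  have WI: "b [^] (j::nat) \<otimes> a [^] (i::nat) \<otimes> t \<in> W" if "t \<in> center" for i j t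
    using that unfolding W_def by blast
  have WG: "w \<in> carrier G" if "w \<in> W" for w using that D(1,2) unfolding W_def by auto
  have Wmult: "w \<otimes> w' \<in> W" if ww: "w \<in> W" "w' \<in> W" for w w'
  proof -
    obtain i j t where w: "w = b [^] (j::nat) \<otimes> a [^] (i::nat) \<otimes> t" "t \<in> center"
      using ww unfolding W_def by blast
    obtain p l s where w': "w' = b [^] (l::nat) \<otimes> a [^] (p::nat) \<otimes> s" "s \<in> center"
      using ww unfolding W_def by blast
    let ?c = "commutator G (a [^] i) (b [^] l)"
    have c: "?c \<in> center" using D(1,2) by simp
    have "w \<otimes> w' = b [^] j \<otimes> (a [^] i \<otimes> b [^] l) \<otimes> a [^] p \<otimes> (t \<otimes> s)"
      using D(1,2) w w' center_commute[of t "b [^] l \<otimes> (a [^] p \<otimes> s)"] center_commute[of t s]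
      by (simp add: m_assoc)
    also have "a [^] i \<otimes> b [^] l = b [^] l \<otimes> a [^] i \<otimes> ?c"
      using D(1,2) by (intro commutator_swap_mult) auto
    also have "b [^] j \<otimes> (b [^] l \<otimes> a [^] i \<otimes> ?c) \<otimes> a [^] p \<otimes> (t \<otimes> s)
        = b [^] j \<otimes> b [^] l \<otimes> (a [^] i \<otimes> a [^] p) \<otimes> (?c \<otimes> (t \<otimes> s))"
      using D(1,2) w(2) w'(2) center_commute[OF c, of "a [^] p \<otimes> (t \<otimes> s)"] center_commute[OF c, of "t \<otimes> s"] c
      by (simp add: m_assoc)
    also have "\<dots> = b [^] (j + l) \<otimes> a [^] (i + p) \<otimes> (?c \<otimes> (t \<otimes> s))"
      using D(1,2) by (simp add: nat_pow_mult)
    finally show ?thesis using WI c w w' by (simp only:) blast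
  qed
  have WZ: "t \<in> W" if "t \<in> center" for t using WI[OF that, of 0 0] that D(1,2) by simp
  have Wa: "a \<in> W" using WI[of \<one> 0 1] D(1,2) by simp
  have Wb: "b \<in> W" using WI[of \<one> 1 0] D(1,2) by simp
  have Wpow: "w [^] (n::nat) \<in> W" if "w \<in> W" for w n
    by (induction n) (use WZ[of \<one>] Wmult that in auto)
  have Winv: "inv w \<in> W" if "w \<in> W" for w
    using inv_pow_exponent[OF WG[OF that]] Wpow[OF that] by simp
  have val: "commutator G y a [^] ((2::nat) ^ k) = \<one> \<or> commutator G y a [^] ((2::nat) ^ k) = \<zeta>"
      "commutator G y b [^] ((2::nat) ^ k) = \<one> \<or> commutator G y b [^] ((2::nat) ^ k) = \<zeta>"
    if "y \<in> carrier G" for y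
  proof -
    have *: "commutator G y g [^] ((2::nat) ^ k) \<otimes> commutator G y g [^] ((2::nat) ^ k) = \<one>"
      if "g \<in> carrier G" "g [^] ?q \<in> center" for g
    proof -
      have "commutator G y g [^] ((2::nat) ^ k) \<otimes> commutator G y g [^] ((2::nat) ^ k) = commutator G y (g [^] ?q)"
        using that \<open>y \<in> carrier G\<close> power_pow_two[of "commutator G y g" k] by (simp only: commutator_pow_right commutator_closed)
      then show ?thesis using that \<open>y \<in> carrier G\<close> by simp
    qed
    show "commutator G y a [^] ((2::nat) ^ k) = \<one> \<or> commutator G y a [^] ((2::nat) ^ k) = \<zeta>"
      using *[OF D(1,4)] that D(1,2) by (intro \<zeta>_unique) auto
    show "commutator G y b [^] ((2::nat) ^ k) = \<one> \<or> commutator G y b [^] ((2::nat) ^ k) = \<zeta>"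
      using *[OF D(2,6)] that D(1,2) by (intro \<zeta>_unique) auto
  qed
  have split: "\<exists>v\<in>carrier G. \<exists>w\<in>W. y = v \<otimes> v \<otimes> w" if y: "y \<in> carrier G" for y
  proof -
    \<comment> \<open>A factor a corrects the commutator with b and a factor b the one with a, each
      leaving the other unchanged; after both corrections y e f lies in
      \<open>G^2 Z\<close>.\<close>
    define e where "e = (if commutator G y b [^] ((2::nat) ^ k) = \<one> then \<one> else a)"
    define f where "f = (if commutator G y a [^] ((2::nat) ^ k) = \<one> then \<one> else b)"
    have ef: "e \<in> W" "f \<in> W" "e \<in> carrier G" "f \<in> carrier G"
      using Wa Wb WZ[of \<one>] D(1,2) by (auto simp: e_def f_def)
    have ba: "commutator G b a [^] ((2::nat) ^ k) = \<zeta>"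
    proof -
      have "commutator G b a [^] ((2::nat) ^ k) = inv (commutator G a b [^] ((2::nat) ^ k))"
        using D(1,2) by (simp add: nat_pow_inv[symmetric] commutator_inv)
      then show ?thesis using D(7) inv_\<zeta> by simp
    qed
    have "commutator G (y \<otimes> e \<otimes> f) a [^] ((2::nat) ^ k) = \<one>"
      using val(1)[OF y] y ef D(1,2) ba \<zeta>
      by (auto simp: commutator_mult_left mult_pow_class_two e_def f_def)
    moreover have "commutator G (y \<otimes> e \<otimes> f) b [^] ((2::nat) ^ k) = \<one>"
      using val(2)[OF y] y ef D(1,2,7) \<zeta>
      by (auto simp: commutator_mult_left mult_pow_class_two e_def f_def)
    ultimately have "y \<otimes> e \<otimes> f \<in> squares_mod_center" using D(8) y ef by simp
    then obtain v t where v: "v \<in> carrier G" "t \<in> center" "y \<otimes> e \<otimes> f = v \<otimes> v \<otimes> t"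
      by (rule squares_mod_centerE)
    have "y = y \<otimes> e \<otimes> f \<otimes> inv f \<otimes> inv e" using y ef by (simp add: m_assoc inv_cancel)
    also have "\<dots> = v \<otimes> v \<otimes> t \<otimes> inv f \<otimes> inv e" by (simp only: v(3))
    also have "\<dots> = v \<otimes> v \<otimes> (t \<otimes> (inv f \<otimes> inv e))" using v ef by (simp add: m_assoc)
    finally have "y = v \<otimes> v \<otimes> (t \<otimes> (inv f \<otimes> inv e))" .
    moreover have "t \<otimes> (inv f \<otimes> inv e) \<in> W" using v ef by (simp add: Wmult WZ Winv)
    ultimately show ?thesis using v(1) by blast
  qed
  have "\<exists>v\<in>carrier G. \<exists>w\<in>W. x = v [^] ((2::nat) ^ n) \<otimes> w" for n
  proof (induction n)
    case 0
    show ?case using x WZ[of \<one>] by (intro bexI[of _ x] bexI[of _ \<one>]) auto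
  next
    case (Suc n)
    then obtain v w where v: "v \<in> carrier G" "w \<in> W" "x = v [^] ((2::nat) ^ n) \<otimes> w" by blast
    obtain u w' where u: "u \<in> carrier G" "w' \<in> W" "v = u \<otimes> u \<otimes> w'" using split[OF v(1)] by blast
    let ?c = "commutator G w' (u \<otimes> u) [^] (2 ^ n choose 2)"
    have "v [^] ((2::nat) ^ n) = (u [^] (2::nat)) [^] ((2::nat) ^ n) \<otimes> w' [^] ((2::nat) ^ n) \<otimes> ?c"
      using u WG[OF u(2)] mult_pow_class_two[of "u \<otimes> u" w' "2 ^ n"] by simp
    also have "(u [^] (2::nat)) [^] ((2::nat) ^ n) = u [^] ((2::nat) ^ Suc n)"
      using u by (simp only: nat_pow_pow power_Suc)
    finally have "x = u [^] ((2::nat) ^ Suc n) \<otimes> (w' [^] ((2::nat) ^ n) \<otimes> ?c \<otimes> w)"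
      using u WG[OF u(2)] WG[OF v(2)] by (simp only: v(3)) (simp add: m_assoc)
    moreover have "w' [^] ((2::nat) ^ n) \<otimes> ?c \<otimes> w \<in> W"
      using u v WG[OF u(2)] by (simp add: Wmult Wpow WZ)
    ultimately show ?case using u by blast
  qed
  from this[of m] obtain v w where "v \<in> carrier G" "w \<in> W" "x = v [^] ((2::nat) ^ m) \<otimes> w" by blast
  then have "x \<in> W" using pow_exponent WG by simp
  then obtain i j t where t: "x = b [^] (j::nat) \<otimes> a [^] (i::nat) \<otimes> t" "t \<in> center"
    unfolding W_def by blast
  obtain l :: nat where "t = (a [^] ?q) [^] l" using center_generated_by_nonsquare[OF D(4,5) t(2)] by blast
  then have "x = b [^] j \<otimes> a [^] (i + ?q * l)"
    using t D(1,2) by (simp add: m_assoc nat_pow_pow nat_pow_mult)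
  then show ?thesis by blast
qed

text \<open>The commutator [a, b] is a power of the generator A = a^(2^r) of the center. The odd
  part of its exponent is removed by replacing b with an odd power, and the 2-part determines
  n.\<close>

theorem metacyclic_generators:
  obtains a b and n r :: nat where "2 \<le> r" "2 * r \<le> n" "a \<in> carrier G" "b \<in> carrier G"
    "a [^] ((2::nat) ^ n) = \<one>" "b [^] ((2::nat) ^ r) = \<one>"
    "a [^] ((2::nat) ^ (n - r)) = commutator G a b"
    "\<And>x. x \<in> carrier G \<Longrightarrow> \<exists>(i::nat) (j::nat). x = b [^] j \<otimes> a [^] i"
    "\<And>(i::nat) (j::nat). b [^] j \<otimes> a [^] i = \<one> \<Longrightarrow> 2 ^ n dvd i \<and> 2 ^ r dvd j"
proof -
  obtain a b' k where ab': "adapted_pair a b' k" "b' [^] ((2::nat) ^ Suc k) = \<one>"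
    by (rule adapted_pair_order_right)
  note D' = adapted_pairD[OF ab'(1)]
  define A where "A = a [^] ((2::nat) ^ Suc k)"
  have AG: "A \<in> carrier G" using D'(1) by (simp add: A_def)
  obtain e :: nat where e: "commutator G a b' = A [^] e"
    unfolding A_def using center_generated_by_nonsquare[OF D'(4,5)] D'(1,2) by blast
  have "e \<noteq> 0" using D'(7) e \<zeta> by (intro notI) simp
  define i where "i = multiplicity 2 e"
  obtain o' where o': "e = 2 ^ i * o'" "odd o'"
    unfolding i_def using multiplicity_decompose'[of e 2] \<open>e \<noteq> 0\<close> by auto
  \<comment> \<open>Raising b' to an inverse j of the odd part raises [a, b'] to j and leaves
    A^(2^i).\<close>
  obtain j where j: "\<And>x. x \<in> carrier G \<Longrightarrow> (x [^] o') [^] (j::nat) = x" "odd j"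
    using odd_root[OF o'(2)] by blast
  define b where "b = b' [^] j"
  have ab: "adapted_pair a b k" and b: "b [^] ((2::nat) ^ Suc k) = \<one>"
    unfolding b_def using adapted_pair_odd_power[OF ab'(1) j(2) ab'(2)] by auto
  note D = adapted_pairD[OF ab]
  have "commutator G a b = (A [^] (2 ^ i * o')) [^] j"
    using D'(1,2) e o' by (simp add: b_def commutator_pow_right)
  also have "A [^] (2 ^ i * o') = (A [^] ((2::nat) ^ i)) [^] o'" using AG by (simp only: nat_pow_pow)
  also have "((A [^] ((2::nat) ^ i)) [^] o') [^] j = A [^] ((2::nat) ^ i)" using AG j by simp
  finally have Dc: "commutator G a b = A [^] ((2::nat) ^ i)" .
  define r where "r = Suc k"
  \<comment> \<open>Forced by A^(2^i) = a^(2^(r+i)) and the required exponent 2^(n-r).\<close>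
  define n where "n = 2 * r + i"
  have "a [^] ((2::nat) ^ (n - r)) = A [^] ((2::nat) ^ i)"
    unfolding A_def using D(1) by (simp add: n_def r_def nat_pow_pow power_add mult.assoc)
  then have rel: "a [^] ((2::nat) ^ (n - r)) = commutator G a b" using Dc by simp
  have n1: "a [^] ((2::nat) ^ (n - 1)) = \<zeta>"
  proof -
    have "n - 1 = (n - r) + k" by (simp add: n_def r_def)
    then have "a [^] ((2::nat) ^ (n - 1)) = (a [^] ((2::nat) ^ (n - r))) [^] ((2::nat) ^ k)"
      using D(1) by (simp add: nat_pow_pow power_add)
    then show ?thesis using rel D(7) by simp
  qed
  have n: "n = Suc (n - 1)" by (simp add: n_def r_def)
  have an: "a [^] ((2::nat) ^ n) = \<one>"
    using power_pow_two[OF D(1), of "n - 1"] n1 \<zeta> n by simp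
  show thesis
  proof (rule that[of r n a b])
    show "2 \<le> r" "2 * r \<le> n" using D(3) by (simp_all add: r_def n_def)
    show "b [^] ((2::nat) ^ r) = \<one>" using b by (simp add: r_def)
    show "\<exists>(i::nat) (j::nat). x = b [^] j \<otimes> a [^] i" if "x \<in> carrier G" for x
      by (rule adapted_pair_generates[OF ab that])
    fix i j :: nat assume ij: "b [^] j \<otimes> a [^] i = \<one>"
    \<comment> \<open>The commutator with a isolates j, since [a, b] has order exactly 2^r; only
      then is i compared with the order 2^n of a.\<close>
    have "commutator G a (b [^] j \<otimes> a [^] i) = commutator G a b [^] j"
      using D(1,2) by (simp add: commutator_mult_right commutator_pow_right)
    then have "commutator G a b [^] j = \<one>" using ij D(1) by simp
    then have "2 ^ r dvd j"
      unfolding r_def by (rule exponent_of_zeta_power[OF commutator_closed[OF D(1,2)] D(7)])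
    then obtain l where "j = 2 ^ r * l" by blast
    then have "b [^] j = \<one>" using b D(2) by (simp add: r_def nat_pow_pow[symmetric] del: power_Suc)
    then have "a [^] i = \<one>" using ij D(1) by simp
    then have "2 ^ Suc (n - 1) dvd i" by (rule exponent_of_zeta_power[OF D(1) n1])
    then have "2 ^ n dvd i" using n by simp
    then show "2 ^ n dvd i \<and> 2 ^ r dvd j" using \<open>2 ^ r dvd j\<close> by blast
  qed (use D(1,2) an rel in auto)
qed

end

section \<open>Recognizing the presented group\<close>

definition eval_letter :: "('a, 'b) monoid_scheme \<Rightarrow> ('g \<Rightarrow> 'a) \<Rightarrow> 'g \<times> bool \<Rightarrow> 'a" where
  "eval_letter H \<phi> c = (if snd c then \<phi> (fst c) else inv\<^bsub>H\<^esub> \<phi> (fst c))"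

primrec eval_word :: "('a, 'b) monoid_scheme \<Rightarrow> ('g \<Rightarrow> 'a) \<Rightarrow> 'g word \<Rightarrow> 'a" where
  "eval_word H \<phi> [] = \<one>\<^bsub>H\<^esub>"
| "eval_word H \<phi> (c # w) = eval_letter H \<phi> c \<otimes>\<^bsub>H\<^esub> eval_word H \<phi> w"

text \<open>Evaluation is constant on a class of words, so the image is a singleton and
  \<open>the_elem\<close> reads off its value.\<close>

definition free_lift :: "('a, 'b) monoid_scheme \<Rightarrow> ('g \<Rightarrow> 'a) \<Rightarrow> 'g word set \<Rightarrow> 'a" where
  "free_lift H \<phi> U = the_elem (eval_word H \<phi> ` U)"

context group
begin

lemma eval_letter_closed: "range \<phi> \<subseteq> carrier G \<Longrightarrow> eval_letter G \<phi> c \<in> carrier G"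
  by (auto simp: eval_letter_def)

lemma eval_word_closed: "range \<phi> \<subseteq> carrier G \<Longrightarrow> eval_word G \<phi> w \<in> carrier G"
  by (induction w) (auto simp: eval_letter_closed)

lemma eval_word_append:
  "range \<phi> \<subseteq> carrier G \<Longrightarrow> eval_word G \<phi> (u @ v) = eval_word G \<phi> u \<otimes> eval_word G \<phi> v"
  by (induction u) (auto simp: eval_letter_closed eval_word_closed m_assoc)

lemma eval_word_cancels:
  assumes \<phi>: "range \<phi> \<subseteq> carrier G" and "cancels u v"
  shows "eval_word G \<phi> u = eval_word G \<phi> v"
  using assms(2)
proof cases
  case (1 p x s q)
  have "\<phi> x \<in> carrier G" using \<phi> by auto
  then have "eval_letter G \<phi> (x, s) \<otimes> (eval_letter G \<phi> (x, \<not> s) \<otimes> eval_word G \<phi> q) = eval_word G \<phi> q"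
    using eval_word_closed[OF \<phi>] by (simp add: eval_letter_def inv_cancel)
  then show ?thesis unfolding 1 by (simp add: eval_word_append[OF \<phi>])
qed

lemma eval_word_free_eq:
  assumes \<phi>: "range \<phi> \<subseteq> carrier G" and "(u, v) \<in> free_eq"
  shows "eval_word G \<phi> u = eval_word G \<phi> v"
proof -
  have "equivclp cancels u v" using assms(2) by (simp add: free_eq_def)
  then show ?thesis
    by (induction rule: equivclp_induct) (auto dest: eval_word_cancels[OF \<phi>])
qed

lemma free_lift_class:
  assumes \<phi>: "range \<phi> \<subseteq> carrier G"
  shows "free_lift G \<phi> (free_eq `` {w}) = eval_word G \<phi> w"
proof -
  have "w \<in> free_eq `` {w}" by (simp add: free_eq_def)
  moreover have "eval_word G \<phi> ` (free_eq `` {w}) = (\<lambda>_. eval_word G \<phi> w) ` (free_eq `` {w})"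
    by (rule image_cong) (simp_all add: eval_word_free_eq[OF \<phi>, of w])
  ultimately have "eval_word G \<phi> ` (free_eq `` {w}) = {eval_word G \<phi> w}" by (simp only: image_constant)
  then show ?thesis by (simp add: free_lift_def)
qed

lemma free_lift_hom:
  assumes \<phi>: "range \<phi> \<subseteq> carrier G"
  shows "free_lift G \<phi> \<in> hom free_group G"
  by (rule homI)
    (auto simp: carrier_free_group free_group_mult free_lift_class[OF \<phi>] eval_word_append[OF \<phi>] eval_word_closed[OF \<phi>])

lemma free_lift_gen:
  "range \<phi> \<subseteq> carrier G \<Longrightarrow> free_lift G \<phi> (free_gen x) = \<phi> x"
  by (auto simp: free_gen_def free_lift_class eval_letter_def image_subset_iff)

end

lemma free_gen_closed [simp]: "free_gen x \<in> carrier free_group"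
  by (simp add: free_gen_def carrier_free_group)

lemma hom_free_group_eq_eval_word:
  assumes "group H" and h: "h \<in> hom free_group H"
  shows "h (free_eq `` {w}) = eval_word H (\<lambda>x. h (free_gen x)) w"
proof -
  interpret group_hom free_group H h
    using assms group_free_group by (simp add: group_hom_def group_hom_axioms_def)
  show ?thesis
  proof (induction w)
    case Nil
    then show ?case using hom_one by (simp add: one_free_group)
  next
    case (Cons c w)
    obtain x s where c: "c = (x, s)" by fastforce
    have "(word_inv [(x, True)] @ [(x, True)], []) \<in> free_eq" by (rule word_inv_left)
    then have "free_eq `` {[(x, False)]} \<otimes>\<^bsub>free_group\<^esub> free_gen x = \<one>\<^bsub>free_group\<^esub>"
      unfolding free_gen_def free_group_mult one_free_group
      by (intro equiv_class_eq[OF equiv_free_eq]) (simp add: word_inv_def)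
    then have inv: "free_eq `` {[(x, False)]} = inv\<^bsub>free_group\<^esub> free_gen x"
      by (intro group.inv_equality[OF group_free_group, symmetric]) (simp_all add: free_gen_def carrier_free_group)
    have "h (free_eq `` {[(x, False)]}) = inv\<^bsub>H\<^esub> h (free_gen x)"
      unfolding inv by (rule hom_inv) simp
    then have letter: "h (free_eq `` {[c]}) = eval_letter H (\<lambda>x. h (free_gen x)) c"
      by (cases s) (simp_all add: c eval_letter_def, simp add: free_gen_def)
    have "h (free_eq `` {c # w}) = h (free_eq `` {[c]} \<otimes>\<^bsub>free_group\<^esub> free_eq `` {w})"
      by (simp add: free_group_mult)
    also have "\<dots> = h (free_eq `` {[c]}) \<otimes>\<^bsub>H\<^esub> h (free_eq `` {w})"
      by (rule hom_mult) (auto simp: carrier_free_group)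
    finally show ?case using Cons letter by simp
  qed
qed

lemma (in group_hom) hom_commutator:
  "x \<in> carrier G \<Longrightarrow> y \<in> carrier G \<Longrightarrow> h (commutator G x y) = commutator H (h x) (h y)"
  by (simp add: commutator_def)

text \<open>Right multiplication of b^j a^i by a letter. Inverse letters count as the powers 2^n - 1
  and 2^r - 1, and a^i passing b^e picks up the factor (1 + 2^(n-r))^e. Exponents are never reduced,
  so the result depends on the word alone.\<close>

definition normal_form_step :: "nat \<Rightarrow> nat \<Rightarrow> nat \<times> nat \<Rightarrow> two_gens \<times> bool \<Rightarrow> nat \<times> nat" where
  "normal_form_step n r p c = (case fst c of
      Gen_a \<Rightarrow> (fst p, snd p + (if snd c then 1 else 2 ^ n - 1))
    | Gen_b \<Rightarrow> let e = (if snd c then 1 else 2 ^ r - 1)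
               in (fst p + e, snd p * (1 + 2 ^ (n - r)) ^ e))"

text \<open>The exponents \<open>(j, i)\<close> of \<open>b\<^sup>j a\<^sup>i\<close>, the value of the word in every group that satisfies the relations.\<close>

definition normal_form :: "nat \<Rightarrow> nat \<Rightarrow> two_gens word \<Rightarrow> nat \<times> nat" where
  "normal_form n r w = foldl (normal_form_step n r) (0, 0) w"

text \<open>Used both for G and for every quotient of the free group by a normal subgroup containing
  the relators.\<close>

locale metacyclic_relations = group +
  fixes a b :: 'a and n r :: nat
  assumes a_closed [simp]: "a \<in> carrier G" and b_closed [simp]: "b \<in> carrier G"
    and a_order: "a [^] ((2::nat) ^ n) = \<one>" and b_order: "b [^] ((2::nat) ^ r) = \<one>"
    and a_commutator: "a [^] ((2::nat) ^ (n - r)) = commutator G a b"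
begin

definition gens :: "two_gens \<Rightarrow> 'a" where
  "gens x = (case x of Gen_a \<Rightarrow> a | Gen_b \<Rightarrow> b)"

lemma range_gens: "range gens \<subseteq> carrier G"
  by (auto simp: gens_def split: two_gens.split)

lemma a_pow_b: "a [^] (i::nat) \<otimes> b = b \<otimes> a [^] (i * (1 + 2 ^ (n - r)))"
proof (induction i)
  case (Suc i)
  have ab: "a \<otimes> b = b \<otimes> a [^] (1 + (2::nat) ^ (n - r))"
    using commutator_swap_mult[of a b] nat_pow_mult[of a 1 "2 ^ (n - r)"]
    by (simp add: m_assoc flip: a_commutator)
  have "a [^] Suc i \<otimes> b = a [^] i \<otimes> (a \<otimes> b)" by (simp add: m_assoc)
  also have "\<dots> = a [^] i \<otimes> b \<otimes> a [^] (1 + (2::nat) ^ (n - r))"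
    unfolding ab by (rule m_assoc[symmetric]) auto
  also have "\<dots> = b \<otimes> (a [^] (i * (1 + 2 ^ (n - r))) \<otimes> a [^] (1 + (2::nat) ^ (n - r)))"
    unfolding Suc by (rule m_assoc) auto
  also have "\<dots> = b \<otimes> a [^] (Suc i * (1 + 2 ^ (n - r)))"
    by (subst nat_pow_mult) (auto simp: add.commute add.left_commute)
  finally show ?case .
qed simp

lemma a_pow_b_pow: "a [^] (i::nat) \<otimes> b [^] (e::nat) = b [^] e \<otimes> a [^] (i * (1 + 2 ^ (n - r)) ^ e)"
proof (induction e)
  case (Suc e)
  have "a [^] i \<otimes> b [^] Suc e = a [^] i \<otimes> b [^] e \<otimes> b" by (simp add: m_assoc)
  also have "\<dots> = b [^] e \<otimes> (a [^] (i * (1 + 2 ^ (n - r)) ^ e) \<otimes> b)"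
    unfolding Suc by (simp add: m_assoc)
  also have "\<dots> = b [^] Suc e \<otimes> a [^] (i * (1 + 2 ^ (n - r)) ^ e * (1 + 2 ^ (n - r)))"
    unfolding a_pow_b by (simp add: m_assoc)
  finally show ?case by (simp only: power_Suc2 mult.assoc)
qed simp

lemma eval_word_normal_form:
  "eval_word G gens w = b [^] fst (normal_form n r w) \<otimes> a [^] snd (normal_form n r w)"
proof (induction w rule: rev_induct)
  case Nil
  then show ?case by (simp add: normal_form_def)
next
  case (snoc c w)
  obtain j i where ji: "normal_form n r w = (j, i)" by fastforce
  have nf: "normal_form n r (w @ [c]) = normal_form_step n r (j, i) c"
    using ji by (simp add: normal_form_def)
  have ev: "eval_word G gens (w @ [c]) = b [^] j \<otimes> a [^] i \<otimes> eval_letter G gens c"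
    using snoc ji eval_letter_closed[OF range_gens] by (simp add: eval_word_append[OF range_gens])
  obtain x s where c: "c = (x, s)" by fastforce
  show ?case
  proof (cases x)
    case Gen_a
    define e :: nat where "e = (if s then 1 else 2 ^ n - 1)"
    have "eval_letter G gens c = a [^] e"
      using inv_eq_pow[OF a_closed a_order] by (simp add: c Gen_a eval_letter_def gens_def e_def)
    then show ?thesis
      unfolding ev nf by (simp add: c Gen_a normal_form_step_def m_assoc nat_pow_mult e_def[symmetric])
  next
    case Gen_b
    define e :: nat where "e = (if s then 1 else 2 ^ r - 1)"
    have "eval_letter G gens c = b [^] e"
      using inv_eq_pow[OF b_closed b_order] by (simp add: c Gen_b eval_letter_def gens_def e_def)
    then have "eval_word G gens (w @ [c]) = b [^] j \<otimes> (a [^] i \<otimes> b [^] e)"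
      unfolding ev by (simp add: m_assoc)
    also have "\<dots> = b [^] (j + e) \<otimes> a [^] (i * (1 + 2 ^ (n - r)) ^ e)"
      unfolding a_pow_b_pow by (simp add: nat_pow_mult flip: m_assoc)
    finally show ?thesis
      unfolding nf by (simp add: c Gen_b normal_form_step_def Let_def e_def[symmetric])
  qed
qed

end

definition metacyclic_relators :: "nat \<Rightarrow> nat \<Rightarrow> two_gens word set set" where
  "metacyclic_relators n r = (let F = free_group; a = free_gen Gen_a; b = free_gen Gen_b in
     {u \<otimes>\<^bsub>F\<^esub> inv\<^bsub>F\<^esub> v | u v. (u, v) \<in> {(a [^]\<^bsub>F\<^esub> ((2::nat) ^ n), \<one>\<^bsub>F\<^esub>),
         (b [^]\<^bsub>F\<^esub> ((2::nat) ^ r), \<one>\<^bsub>F\<^esub>),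
         (a [^]\<^bsub>F\<^esub> ((2::nat) ^ (n - r)), commutator F a b)}})"

lemma metacyclic_2group_eq:
  "metacyclic_2group n r = free_group Mod normal_closure free_group (metacyclic_relators n r)"
  by (simp only: metacyclic_2group_def presented_group_def metacyclic_relators_def Let_def)

lemma relations_in_quotient:
  assumes M: "M \<lhd> free_group" and rel: "metacyclic_relators n r \<subseteq> M"
  shows "metacyclic_relations (free_group Mod M) (M #>\<^bsub>free_group\<^esub> free_gen Gen_a)
    (M #>\<^bsub>free_group\<^esub> free_gen Gen_b) n r"
proof -
  let ?F = "free_group :: two_gens word set monoid" and ?\<pi> = "\<lambda>x. M #>\<^bsub>free_group\<^esub> x"
  let ?a = "free_gen Gen_a" and ?b = "free_gen Gen_b"
  interpret M: normal M ?F by (rule M)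
  interpret Q: group "?F Mod M" by (rule M.factorgroup_is_group)
  interpret \<pi>: group_hom ?F "?F Mod M" ?\<pi>
    using M.r_coset_hom_Mod by (simp add: group_hom_def group_hom_axioms_def M.is_group Q.is_group)
  have eq: "?\<pi> u = ?\<pi> v" if "u \<otimes>\<^bsub>?F\<^esub> inv\<^bsub>?F\<^esub> v \<in> M" "u \<in> carrier ?F" "v \<in> carrier ?F" for u v
  proof -
    have "?\<pi> (u \<otimes>\<^bsub>?F\<^esub> inv\<^bsub>?F\<^esub> v) = \<one>\<^bsub>?F Mod M\<^esub>"
      using that M.coset_join2[OF _ M.subgroup_axioms that(1)] by (simp add: FactGroup_def)
    then have "?\<pi> u \<otimes>\<^bsub>?F Mod M\<^esub> inv\<^bsub>?F Mod M\<^esub> ?\<pi> v = \<one>\<^bsub>?F Mod M\<^esub>" using that by simp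
    then show ?thesis using that by (metis Q.inv_equality Q.inv_inv \<pi>.hom_closed Q.inv_closed)
  qed
  have r1: "?a [^]\<^bsub>?F\<^esub> ((2::nat) ^ n) \<otimes>\<^bsub>?F\<^esub> inv\<^bsub>?F\<^esub> \<one>\<^bsub>?F\<^esub> \<in> M"
    and r2: "?b [^]\<^bsub>?F\<^esub> ((2::nat) ^ r) \<otimes>\<^bsub>?F\<^esub> inv\<^bsub>?F\<^esub> \<one>\<^bsub>?F\<^esub> \<in> M"
    and r3: "?a [^]\<^bsub>?F\<^esub> ((2::nat) ^ (n - r)) \<otimes>\<^bsub>?F\<^esub> inv\<^bsub>?F\<^esub> commutator ?F ?a ?b \<in> M"
    using rel unfolding metacyclic_relators_def Let_def by blast+
  have c: "commutator ?F ?a ?b \<in> carrier ?F" by (simp add: M.commutator_closed)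
  show ?thesis
  proof unfold_locales
    show "?\<pi> ?a \<in> carrier (?F Mod M)" "?\<pi> ?b \<in> carrier (?F Mod M)" by (rule \<pi>.hom_closed, simp)+
    show "?\<pi> ?a [^]\<^bsub>?F Mod M\<^esub> ((2::nat) ^ n) = \<one>\<^bsub>?F Mod M\<^esub>"
      using eq[OF r1] by (simp only: \<pi>.hom_nat_pow[symmetric] free_gen_closed M.nat_pow_closed M.one_closed \<pi>.hom_one)
    show "?\<pi> ?b [^]\<^bsub>?F Mod M\<^esub> ((2::nat) ^ r) = \<one>\<^bsub>?F Mod M\<^esub>"
      using eq[OF r2] by (simp only: \<pi>.hom_nat_pow[symmetric] free_gen_closed M.nat_pow_closed M.one_closed \<pi>.hom_one)
    show "?\<pi> ?a [^]\<^bsub>?F Mod M\<^esub> ((2::nat) ^ (n - r)) = commutator (?F Mod M) (?\<pi> ?a) (?\<pi> ?b)"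
      using eq[OF r3 _ c] by (simp only: \<pi>.hom_nat_pow[symmetric] \<pi>.hom_commutator[symmetric] free_gen_closed M.nat_pow_closed)
  qed
qed

context metacyclic_relations
begin

text \<open>It suffices that the kernel of the evaluation onto G is the normal closure of the
  relators. For a word in the kernel, \<open>faithful\<close> makes the exponents of its normal form
  divisible by 2^n and 2^r; the same normal form then evaluates to 1 in the quotient by any M
  containing the relators.\<close>

theorem iso_metacyclic_2group:
  assumes gen: "\<And>x. x \<in> carrier G \<Longrightarrow> \<exists>(i::nat) (j::nat). x = b [^] j \<otimes> a [^] i"
    and faithful: "\<And>(i::nat) (j::nat). b [^] j \<otimes> a [^] i = \<one> \<Longrightarrow> 2 ^ n dvd i \<and> 2 ^ r dvd j"
  shows "G \<cong> metacyclic_2group n r"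
proof -
  let ?F = "free_group :: two_gens word set monoid"
  let ?a = "free_gen Gen_a" and ?b = "free_gen Gen_b"
  define h where "h = free_lift G gens"
  interpret h: group_hom ?F G h
    using free_lift_hom[OF range_gens] by (simp add: h_def group_hom_def group_hom_axioms_def group_free_group is_group)
  have hab: "h ?a = a" "h ?b = b"
    by (simp_all add: h_def free_lift_gen[OF range_gens] gens_def)
  have surj: "h ` carrier ?F = carrier G"
  proof
    show "carrier G \<subseteq> h ` carrier ?F"
    proof
      fix x assume "x \<in> carrier G"
      then obtain i j :: nat where "x = b [^] j \<otimes> a [^] i" using gen by blast
      then have "x = h (?b [^]\<^bsub>?F\<^esub> j \<otimes>\<^bsub>?F\<^esub> ?a [^]\<^bsub>?F\<^esub> i)"
        by (simp add: h.hom_nat_pow hab)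
      moreover have "?b [^]\<^bsub>?F\<^esub> j \<otimes>\<^bsub>?F\<^esub> ?a [^]\<^bsub>?F\<^esub> i \<in> carrier ?F" by simp
      ultimately show "x \<in> h ` carrier ?F" by blast
    qed
  qed (use h.hom_closed in blast)
  have rel: "metacyclic_relators n r \<subseteq> kernel ?F G h"
    unfolding metacyclic_relators_def Let_def kernel_def
    by (auto simp: h.hom_nat_pow h.hom_commutator hab a_order b_order a_commutator h.G.commutator_closed commutator_closed)
  have "kernel ?F G h \<subseteq> M" if M: "M \<lhd> ?F" "metacyclic_relators n r \<subseteq> M" for M
  proof
    fix x assume x: "x \<in> kernel ?F G h"
    then have xF: "x \<in> carrier ?F" by (simp add: kernel_def)
    then obtain w where w: "x = free_eq `` {w}" by (auto simp: carrier_free_group)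
    obtain j i where ji: "normal_form n r w = (j, i)" by fastforce
    have "b [^] j \<otimes> a [^] i = \<one>"
      using x eval_word_normal_form[of w] ji
      by (simp add: kernel_def w h_def free_lift_class[OF range_gens])
    then have "2 ^ n dvd i" "2 ^ r dvd j" using faithful by auto
    then obtain k l where i: "i = 2 ^ n * k" and j: "j = 2 ^ r * l" unfolding dvd_def by blast
    let ?\<pi> = "\<lambda>x. M #>\<^bsub>free_group\<^esub> x"
    interpret M: normal M ?F by (rule M)
    interpret Q: metacyclic_relations "?F Mod M" "?\<pi> ?a" "?\<pi> ?b" n r
      by (rule relations_in_quotient[OF M])
    have gens: "Q.gens = (\<lambda>x. ?\<pi> (free_gen x))"
      by (auto simp: Q.gens_def fun_eq_iff split: two_gens.split)
    have "?\<pi> x = eval_word (?F Mod M) Q.gens w"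
      unfolding w gens by (rule hom_free_group_eq_eval_word[OF Q.is_group M.r_coset_hom_Mod])
    also have "\<dots> = ?\<pi> ?b [^]\<^bsub>?F Mod M\<^esub> j \<otimes>\<^bsub>?F Mod M\<^esub> ?\<pi> ?a [^]\<^bsub>?F Mod M\<^esub> i"
      unfolding Q.eval_word_normal_form by (simp add: ji)
    also have "?\<pi> ?b [^]\<^bsub>?F Mod M\<^esub> j = \<one>\<^bsub>?F Mod M\<^esub>"
      unfolding j Q.nat_pow_pow[OF Q.b_closed, symmetric] Q.b_order by (rule Q.nat_pow_one)
    also have "?\<pi> ?a [^]\<^bsub>?F Mod M\<^esub> i = \<one>\<^bsub>?F Mod M\<^esub>"
      unfolding i Q.nat_pow_pow[OF Q.a_closed, symmetric] Q.a_order by (rule Q.nat_pow_one)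
    finally have "?\<pi> x = \<one>\<^bsub>?F Mod M\<^esub>" by (simp only: Q.l_one Q.one_closed)
    then have "M #>\<^bsub>?F\<^esub> x = M" by (simp add: FactGroup_def)
    then show "x \<in> M" using h.G.coset_join1[OF _ xF M.subgroup_axioms] by simp
  qed
  then have "kernel ?F G h = normal_closure ?F (metacyclic_relators n r)"
    unfolding normal_closure_def using rel h.normal_kernel by blast
  then have "metacyclic_2group n r = ?F Mod kernel ?F G h" by (simp add: metacyclic_2group_eq)
  then have "metacyclic_2group n r \<cong> G" using h.FactGroup_iso[OF surj] by simp
  moreover have "group (metacyclic_2group n r)"
    unfolding \<open>metacyclic_2group n r = _\<close> by (rule normal.factorgroup_is_group[OF h.normal_kernel])
  ultimately show ?thesis by (rule group.iso_sym[rotated])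
qed

end

section \<open>The main theorem\<close>

text \<open>With indexing from 0, index 1 is the derived subgroup and index 2 its commutators with
  G; so the first is nontrivial and consists of central elements.\<close>

lemma (in group) class_two_groupI:
  assumes "has_nilpotency_class G 2"
  shows "class_two_group G"
    and "\<exists>x\<in>carrier G. \<exists>y\<in>carrier G. commutator G x y \<noteq> \<one>"
proof -
  have lc1: "lower_central G (Suc 0) \<noteq> {\<one>}" and lc2: "lower_central G (Suc (Suc 0)) = {\<one>}"
    using assms by (auto simp: has_nilpotency_class_def numeral_2_eq_2 simp del: lower_central.simps)
  show "class_two_group G"
  proof unfold_locales
    fix x y assume xy: "x \<in> carrier G" "y \<in> carrier G"
    have c1: "commutator G x y \<in> lower_central G (Suc 0)"
      using xy by (auto intro!: generate.incl)
    have "commutator G (commutator G x y) w = \<one>" if "w \<in> carrier G" for w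
    proof -
      have "commutator G (commutator G x y) w \<in> lower_central G (Suc (Suc 0))"
        unfolding lower_central.simps(2)[of G "Suc 0"] using c1 that by (intro generate.incl) blast
      then show ?thesis using lc2 by simp
    qed
    then show "commutator G x y \<in> center"
      using xy by (intro centerI) (auto simp: commutator_eq_one_iff)
  qed
  show "\<exists>x\<in>carrier G. \<exists>y\<in>carrier G. commutator G x y \<noteq> \<one>"
  proof (rule ccontr)
    assume "\<not> ?thesis"
    then have trivial: "commutator G x y = \<one>" if "x \<in> carrier G" "y \<in> carrier G" for x y
      using that by blast
    have "{commutator G x y | x y. x \<in> lower_central G 0 \<and> y \<in> carrier G} = {\<one>}"
      by (auto simp: trivial intro!: exI[of _ \<one>])
    then show False using lc1 by (simp add: generate_one)
  qed
qed

text \<open>The restriction makes the function extensional as \<open>auto\<close> demands; the moved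
  point x excludes order 1.\<close>

lemma (in group) involution_in_auto:
  assumes closed: "\<And>x. x \<in> carrier G \<Longrightarrow> \<alpha> x \<in> carrier G"
    and mult: "\<And>x y. x \<in> carrier G \<Longrightarrow> y \<in> carrier G \<Longrightarrow> \<alpha> (x \<otimes> y) = \<alpha> x \<otimes> \<alpha> y"
    and invol: "\<And>x. x \<in> carrier G \<Longrightarrow> \<alpha> (\<alpha> x) = x"
    and x: "x \<in> carrier G" "\<alpha> x \<noteq> x"
  shows "restrict \<alpha> (carrier G) \<in> auto G"
    and "group.ord (AutoGroup G) (restrict \<alpha> (carrier G)) = 2"
proof -
  let ?f = "restrict \<alpha> (carrier G)"
  have "bij_betw \<alpha> (carrier G) (carrier G)"
    by (rule bij_betw_byWitness[of _ \<alpha>]) (use closed invol in auto)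
  then have bij: "?f \<in> Bij (carrier G)" by (simp add: Bij_def bij_betw_restrict_eq)
  moreover have "?f \<in> hom G G" using closed mult by (auto simp: hom_def)
  ultimately show f: "?f \<in> auto G" by (simp add: auto_def)
  interpret A: group "AutoGroup G" by (rule AutoGroup)
  have fA: "?f \<in> carrier (AutoGroup G)" using f by (simp add: AutoGroup_def)
  have one: "\<one>\<^bsub>AutoGroup G\<^esub> = (\<lambda>x\<in>carrier G. x)" by (simp add: AutoGroup_def BijGroup_def)
  have "?f \<otimes>\<^bsub>AutoGroup G\<^esub> ?f = compose (carrier G) ?f ?f"
    using bij by (simp add: AutoGroup_def BijGroup_def)
  also have "\<dots> = \<one>\<^bsub>AutoGroup G\<^esub>"
    unfolding one using closed invol by (auto simp: compose_def fun_eq_iff)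
  finally have "?f [^]\<^bsub>AutoGroup G\<^esub> (2::nat) = \<one>\<^bsub>AutoGroup G\<^esub>" using fA by simp
  then have "A.ord ?f dvd 2" using A.pow_eq_id fA by blast
  moreover have "A.ord ?f \<noteq> 1"
  proof
    assume "A.ord ?f = 1"
    then have "?f [^]\<^bsub>AutoGroup G\<^esub> (1::nat) = \<one>\<^bsub>AutoGroup G\<^esub>"
      using A.pow_ord_eq_1[OF fA] by metis
    then have "?f = (\<lambda>x\<in>carrier G. x)" unfolding A.nat_pow_eone[OF fA] one .
    then show False using x by (metis restrict_apply')
  qed
  ultimately show "A.ord ?f = 2" using two_is_prime_nat prime_nat_iff by blast
qed

lemma (in group) rigid_two_groupI:
  assumes "finite (carrier G)" and "order G = 2 ^ m" and "has_nilpotency_class G 2"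
    and "\<And>f. f \<in> auto G \<Longrightarrow> group.ord (AutoGroup G) f = 2 \<Longrightarrow>
           (\<forall>x\<in>Frattini G. f x = x) \<Longrightarrow> f \<in> inner_auto G"
  shows "rigid_two_group G m"
proof -
  interpret class_two_group G by (rule class_two_groupI(1)[OF assms(3)])
  show ?thesis
  proof
    show "finite (carrier G)" by (rule assms(1))
    show "x [^] ((2::nat) ^ m) = \<one>" if "x \<in> carrier G" for x
      using pow_order_eq_1[OF that] assms(2) by simp
    show "\<exists>x\<in>carrier G. \<exists>y\<in>carrier G. commutator G x y \<noteq> \<one>"
      by (rule class_two_groupI(2)[OF assms(3)])
    fix \<alpha> assume \<alpha>: "\<And>x. x \<in> carrier G \<Longrightarrow> \<alpha> x \<in> carrier G"
      "\<And>x y. x \<in> carrier G \<Longrightarrow> y \<in> carrier G \<Longrightarrow> \<alpha> (x \<otimes> y) = \<alpha> x \<otimes> \<alpha> y"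
      "\<And>x. x \<in> carrier G \<Longrightarrow> \<alpha> (\<alpha> x) = x"
      and fixed: "\<And>x. x \<in> carrier G \<Longrightarrow> \<forall>\<chi>. binary_character G \<chi> \<longrightarrow> \<not> \<chi> x \<Longrightarrow> \<alpha> x = x"
    show "\<exists>g\<in>carrier G. \<forall>x\<in>carrier G. \<alpha> x = x \<otimes> commutator G x g"
    \<comment> \<open>The identity has order 1, outside the scope of the hypothesis on
      automorphisms; it is conjugation by 1.\<close>
    proof (cases "\<forall>x\<in>carrier G. \<alpha> x = x")
      case True
      then show ?thesis by (intro bexI[of _ \<one>]) auto
    next
      case False
      then obtain x where x: "x \<in> carrier G" "\<alpha> x \<noteq> x" by blast
      have "\<forall>y\<in>Frattini G. restrict \<alpha> (carrier G) y = y"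
        using fixed Frattini_binary_character by (auto simp: Frattini_def)
      then have "restrict \<alpha> (carrier G) \<in> inner_auto G"
        using assms(4) involution_in_auto[OF \<alpha> x] by blast
      then obtain g where g: "g \<in> carrier G"
        "restrict \<alpha> (carrier G) = (\<lambda>x\<in>carrier G. inv g \<otimes> x \<otimes> g)"
        by (auto simp: inner_auto_def)
      have "\<alpha> y = y \<otimes> commutator G y g" if "y \<in> carrier G" for y
        using fun_cong[OF g(2), of y] that g(1) by (simp add: conj_eq_mult_commutator)
      then show ?thesis using g(1) by blast
      qed
qed
qed

lemma (in rigid_two_group) iso_metacyclic: "\<exists>r n. 2 \<le> r \<and> 2 * r \<le> n \<and> G \<cong> metacyclic_2group n r"
proof -
  obtain a b and n r :: nat where *: "2 \<le> r" "2 * r \<le> n" "a \<in> carrier G" "b \<in> carrier G"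
    "a [^] ((2::nat) ^ n) = \<one>" "b [^] ((2::nat) ^ r) = \<one>"
    "a [^] ((2::nat) ^ (n - r)) = commutator G a b"
    "\<And>x. x \<in> carrier G \<Longrightarrow> \<exists>(i::nat) (j::nat). x = b [^] j \<otimes> a [^] i"
    "\<And>(i::nat) (j::nat). b [^] j \<otimes> a [^] i = \<one> \<Longrightarrow> 2 ^ n dvd i \<and> 2 ^ r dvd j"
    using metacyclic_generators by metis
  interpret metacyclic_relations G a b n r
    by unfold_locales (use * in auto)
  have "G \<cong> metacyclic_2group n r" by (rule iso_metacyclic_2group) (use *(8,9) in auto)
  then show ?thesis using *(1,2) by blast
qed

theorem theorem1p1:
  fixes G :: "('a, 'b) monoid_scheme"
  assumes "group G"
    and "finite (carrier G)"
    and "\<exists>m::nat. order G = 2 ^ m"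
    and "has_nilpotency_class G 2"
    and "\<And>f. f \<in> auto G \<Longrightarrow> group.ord (AutoGroup G) f = 2 \<Longrightarrow>
           (\<forall>x\<in>Frattini G. f x = x) \<Longrightarrow> f \<in> inner_auto G"
  shows "\<exists>r n::nat. 0 < r \<and> 0 < n \<and> 2 < 2 * r \<and> 2 * r \<le> n \<and> G \<cong> metacyclic_2group n r"
proof -
  obtain m :: nat where m: "order G = 2 ^ m" using assms(3) by blast
  have "rigid_two_group G m"
    using assms(5) by (intro group.rigid_two_groupI[OF assms(1,2) m assms(4)])
  from rigid_two_group.iso_metacyclic[OF this]
  obtain r n where "2 \<le> r" "2 * r \<le> n" "G \<cong> metacyclic_2group n r" by blast
  then show ?thesis by (intro exI[of _ r] exI[of _ n]) auto
qed

end
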